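(* Let $p$ be a prime, $n,m\ge1$, and $1\le q,r_1^*,\dots,r_m^*,q_1^*,\dots,q_m^*,\zeta<\infty$. Let $\omega\in A_\zeta(\mathbb Q_p^n)$ with finite critical index $r_\omega$ for the reverse Hölder condition, $\delta\in(1,r_\omega)$, $\Omega\in L^{q'}(S_0)$, $\lambda_i\in\left(-\frac1{q_i^*},0\right)$ and $b_i\in\dot{CMO}^{r_i^*}_\omega(\mathbb Q_p^n)$ for $i=1,\dots,m$, and $\lambda^*=\lambda_1+\cdots+\lambda_m$. Assume $$\frac1q>\Big(\frac1{r_1^*}+\cdots+\frac1{r_m^*}+\frac1{q_1^*}+\cdots+\frac1{q_m^*}\Big)\zeta\frac{r_\omega}{r_\omega-1}$$ and $$\mathcal C_7=\sum_{\gamma\ge0}\frac{\Phi(p^\gamma)}{p^{\gamma(1+n\zeta\lambda^* )}}(2+p^{\gamma\zeta n})^m+\sum_{\gamma<0}\frac{\Phi(p^\gamma)}{p^{\gamma(1+n\lambda^*(\delta-1)/\delta)}}(2+p^{-\gamma\zeta n})^m<\infty.$$ Then $\mathcal H^p_{\Phi,\Omega,\vec b}$ is bounded from $\dot B^{q_1^*,\lambda_1}_\omega(\mathbb Q_p^n)\times\cdots\times\dot B^{q_m^*,\lambda_m}_\omega(\mathbb Q_p^n)$ to $\dot B^{q,\lambda^*}_\omega(\mathbb Q_p^n)$.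
   Context: $\mathbb Q_p$ is the field of $p$-adic numbers with norm $|\cdot|_p$; on $\mathbb Q_p^n$, $|x|_p=\max_j|x_j|_p$. $B_\gamma=\{|x|_p\le p^\gamma\}$, $S_\gamma=\{|x|_p=p^\gamma\}$, balls are sets $\{|x-a|_p\le p^\gamma\}$, $dx$ is Haar measure with $|B_0|=1$. $\Phi:\mathbb Q_p\to[0,\infty)$, $\Omega:S_0\to\mathbb C$ measurable, $\Omega\ne0$ a.e.; $q'$ is the conjugate exponent. For $\vec b=(b_1,\dots,b_m)$ locally integrable, the commutator is $$\mathcal H^p_{\Phi,\Omega,\vec b}(\vec f)(x)=\sum_{\gamma\in\mathbb Z}\int_{S_0}\frac{\Phi(p^\gamma)}{p^\gamma}\Omega(y)\prod_{i=1}^m\big(b_i(x)-b_i(p^\gamma|x|_p^{-1}y)\big)\prod_{i=1}^mf_i(p^\gamma|x|_p^{-1}y)\,dy.$$ For a weight $\omega$, $\omega(E)=\int_E\omega$. $\dot B^{s,\mu}_\omega(\mathbb Q_p^n)$ consists of $f\in L^s_{\omega,\mathrm{loc}}$ with $\|f\|=\sup_{\gamma}\big(\omega(B_\gamma)^{-1-\mu s}\int_{B_\gamma}|f|^s\omega\big)^{1/s}<\infty$. $\dot{CMO}^r_\omega(\mathbb Q_p^n)$ consists of $f\in L^r_{\omega,\mathrm{loc}}$ with $\sup_{\gamma}\big(\frac1{\omega(B_\gamma)}\int_{B_\gamma}|f-f_{\omega,B_\gamma}|^r\omega\big)^{1/r}<\infty$, where $f_{\omega,B_\gamma}=\frac1{\omega(B_\gamma)}\int_{B_\gamma}f\omega$.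 For $1<\zeta<\infty$, $\omega\in A_\zeta$ if $\big(\frac1{|B|}\int_B\omega\big)\big(\frac1{|B|}\int_B\omega^{-1/(\zeta-1)}\big)^{\zeta-1}\le C$ for all balls; $\omega\in A_1$ if $\frac1{|B|}\int_B\omega\le C\,\mathrm{ess\,inf}_B\omega$. $\omega\in RH_r$ ($r>1$) if $\big(\frac1{|B|}\int_B\omega^r\big)^{1/r}\le\frac C{|B|}\int_B\omega$ for all balls, and $r_\omega=\sup\{r>1:\omega\in RH_r\}$. Bounded means $\|\mathcal H^p_{\Phi,\Omega,\vec b}(\vec f)\|_Y\le C\prod_i\|f_i\|_{X_i}$ for all $f_i\in X_i$. *)

theory Defs
  imports "HOL-Analysis.Analysis"
begin

text \<open>A p-adic number x = sum_k a_k p^k is represented by its canonical digit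
 function a :: int => nat, with 0 <= a_k < p and a_k = 0 for all sufficiently
 negative k.  Elements of Q_p^n are vectors of such digit functions, indexed
 by a finite type 'n (n = CARD('n)).\<close>

type_synonym padic = "int \<Rightarrow> nat"

definition qp :: "nat \<Rightarrow> padic set" where
  "qp p = {a. (\<forall>k. a k < p) \<and> (\<exists>N. \<forall>k<N. a k = 0)}"

definition qpn :: "nat \<Rightarrow> (padic ^ 'n) set" where
  "qpn p = {x. \<forall>i. x $ i \<in> qp p}"

text \<open>p-adic distance |a - b|_p: two p-adic numbers satisfy
 |a - b|_p <= p^(-k) iff their digits of index < k coincide.\<close>
definition pdist :: "nat \<Rightarrow> padic \<Rightarrow> padic \<Rightarrow> real" where
  "pdist p a b = (if a = b then 0 else real p powr (- real_of_int (LEAST k. a k \<noteq> b k)))"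

definition pzero :: padic where "pzero = (\<lambda>k. 0)"

definition pnorm :: "nat \<Rightarrow> padic \<Rightarrow> real" where
  "pnorm p a = pdist p a pzero"

definition pdistn :: "nat \<Rightarrow> padic ^ 'n \<Rightarrow> padic ^ 'n \<Rightarrow> real" where
  "pdistn p x y = Max (range (\<lambda>i. pdist p (x $ i) (y $ i)))"

definition pnormn :: "nat \<Rightarrow> padic ^ 'n \<Rightarrow> real" where
  "pnormn p x = Max (range (\<lambda>i. pnorm p (x $ i)))"

text \<open>the p-adic valuation of x in Q_p^n \ {0}: |x|_p = p^(- pvaln x)\<close>
definition pvaln :: "padic ^ 'n \<Rightarrow> int" where
  "pvaln x = (LEAST k. \<exists>i. (x $ i) k \<noteq> 0)"

definition ppow :: "int \<Rightarrow> padic" where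
  "ppow k = (\<lambda>j. if j = k then 1 else 0)"

text \<open>multiplication by p^k: p^k * (sum_j a_j p^j) = sum_j a_(j-k) p^j\<close>
definition pshift :: "int \<Rightarrow> padic \<Rightarrow> padic" where
  "pshift k a = (\<lambda>j. a (j - k))"

definition pshiftn :: "int \<Rightarrow> padic ^ 'n \<Rightarrow> padic ^ 'n" where
  "pshiftn k y = (\<chi> i. pshift k (y $ i))"

text \<open>p^gamma |x|_p^(-1) y  (= p^(gamma + v(x)) y)\<close>
definition pdil :: "int \<Rightarrow> padic ^ 'n \<Rightarrow> padic ^ 'n \<Rightarrow> padic ^ 'n" where
  "pdil \<gamma> x y = pshiftn (\<gamma> + pvaln x) y"

text \<open>Haar measure on Q_p^n is the image of Lebesgue measure on [0,oo)^n under
 the base-p digit map (inverse of the Monna map sum_k a_k p^k |-> sum_k a_k p^(-k-1)),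
 applied coordinatewise.  It gives the ball {|x - a|_p <= p^g} measure p^(n g),
 and |B_0| = 1.\<close>
definition pdigits :: "nat \<Rightarrow> real \<Rightarrow> padic" where
  "pdigits p t = (\<lambda>k. nat (\<lfloor>t * real p powr real_of_int (k + 1)\<rfloor> mod int p))"

definition orthant :: "(real ^ 'n) set" where
  "orthant = {t. \<forall>i. 0 \<le> t $ i}"

definition pdigitsn :: "nat \<Rightarrow> real ^ 'n \<Rightarrow> padic ^ 'n" where
  "pdigitsn p t = (\<chi> i. pdigits p (t $ i))"

definition haar :: "nat \<Rightarrow> (padic ^ 'n) measure" where
  "haar p = measure_of UNIV
     {A. pdigitsn p -` A \<inter> orthant \<in> sets (lebesgue :: (real ^ 'n) measure)}
     (\<lambda>A. emeasure (lebesgue :: (real ^ 'n) measure) (pdigitsn p -` A \<inter> orthant))"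

definition pball :: "nat \<Rightarrow> padic ^ 'n \<Rightarrow> int \<Rightarrow> (padic ^ 'n) set" where
  "pball p a \<gamma> = {x \<in> qpn p. pdistn p x a \<le> real p powr real_of_int \<gamma>}"

definition Bg :: "nat \<Rightarrow> int \<Rightarrow> (padic ^ 'n) set" where
  "Bg p \<gamma> = {x \<in> qpn p. pnormn p x \<le> real p powr real_of_int \<gamma>}"

definition Sg :: "nat \<Rightarrow> int \<Rightarrow> (padic ^ 'n) set" where
  "Sg p \<gamma> = {x \<in> qpn p. pnormn p x = real p powr real_of_int \<gamma>}"

definition is_pball :: "nat \<Rightarrow> (padic ^ 'n) set \<Rightarrow> bool" where
  "is_pball p B \<longleftrightarrow> (\<exists>a \<in> qpn p. \<exists>\<gamma>. B = pball p a \<gamma>)"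

definition wmeas :: "nat \<Rightarrow> (padic ^ 'n \<Rightarrow> real) \<Rightarrow> (padic ^ 'n) set \<Rightarrow> real" where
  "wmeas p w E = (LINT x : E | haar p. w x)"

definition is_weight :: "nat \<Rightarrow> (padic ^ 'n \<Rightarrow> real) \<Rightarrow> bool" where
  "is_weight p w \<longleftrightarrow> w \<in> borel_measurable (haar p) \<and> (\<forall>x. 0 \<le> w x)
     \<and> (AE x in haar p. 0 < w x)
     \<and> (\<forall>B. is_pball p B \<longrightarrow> set_integrable (haar p) B w)"

definition ess_inf_on :: "'a measure \<Rightarrow> 'a set \<Rightarrow> ('a \<Rightarrow> real) \<Rightarrow> real" where
  "ess_inf_on M B f = Sup {c. AE x in M. x \<in> B \<longrightarrow> c \<le> f x}"

definition A_class :: "nat \<Rightarrow> real \<Rightarrow> (padic ^ 'n \<Rightarrow> real) \<Rightarrow> bool" where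
  "A_class p \<zeta> w \<longleftrightarrow> is_weight p w \<and>
    (if \<zeta> = 1 then
       (\<exists>C. \<forall>B. is_pball p B \<longrightarrow>
          (LINT x : B | haar p. w x) / measure (haar p) B \<le> C * ess_inf_on (haar p) B w)
     else
       (\<exists>C. \<forall>B. is_pball p B \<longrightarrow>
          set_integrable (haar p) B (\<lambda>x. w x powr (- 1 / (\<zeta> - 1))) \<and>
          ((LINT x : B | haar p. w x) / measure (haar p) B) *
          ((LINT x : B | haar p. w x powr (- 1 / (\<zeta> - 1))) / measure (haar p) B) powr (\<zeta> - 1)
            \<le> C))"

definition RH_class :: "nat \<Rightarrow> real \<Rightarrow> (padic ^ 'n \<Rightarrow> real) \<Rightarrow> bool" where
  "RH_class p r w \<longleftrightarrow>
    (\<exists>C. \<forall>B. is_pball p B \<longrightarrow>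
       set_integrable (haar p) B (\<lambda>x. w x powr r) \<and>
       ((LINT x : B | haar p. w x powr r) / measure (haar p) B) powr (1 / r)
         \<le> C / measure (haar p) B * (LINT x : B | haar p. w x))"

definition RH_indices :: "nat \<Rightarrow> (padic ^ 'n \<Rightarrow> real) \<Rightarrow> real set" where
  "RH_indices p w = {r. 1 < r \<and> RH_class p r w}"

definition r_crit :: "nat \<Rightarrow> (padic ^ 'n \<Rightarrow> real) \<Rightarrow> real" where
  "r_crit p w = Sup (RH_indices p w)"

definition B_term :: "nat \<Rightarrow> (padic ^ 'n \<Rightarrow> real) \<Rightarrow> real \<Rightarrow> real \<Rightarrow> (padic ^ 'n \<Rightarrow> complex) \<Rightarrow> int \<Rightarrow> real" where
  "B_term p w s \<mu> f \<gamma> =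
     (wmeas p w (Bg p \<gamma>) powr (- 1 - \<mu> * s) *
      (LINT x : Bg p \<gamma> | haar p. cmod (f x) powr s * w x)) powr (1 / s)"

definition B_space :: "nat \<Rightarrow> (padic ^ 'n \<Rightarrow> real) \<Rightarrow> real \<Rightarrow> real \<Rightarrow> (padic ^ 'n \<Rightarrow> complex) set" where
  "B_space p w s \<mu> = {f. f \<in> borel_measurable (haar p) \<and>
      (\<forall>\<gamma>. set_integrable (haar p) (Bg p \<gamma>) (\<lambda>x. cmod (f x) powr s * w x)) \<and>
      bdd_above (range (B_term p w s \<mu> f))}"

definition B_norm :: "nat \<Rightarrow> (padic ^ 'n \<Rightarrow> real) \<Rightarrow> real \<Rightarrow> real \<Rightarrow> (padic ^ 'n \<Rightarrow> complex) \<Rightarrow> real" where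
  "B_norm p w s \<mu> f = (SUP \<gamma>. B_term p w s \<mu> f \<gamma>)"

definition wmean :: "nat \<Rightarrow> (padic ^ 'n \<Rightarrow> real) \<Rightarrow> (padic ^ 'n) set \<Rightarrow> (padic ^ 'n \<Rightarrow> complex) \<Rightarrow> complex" where
  "wmean p w B f = (LINT x : B | haar p. complex_of_real (w x) * f x) / complex_of_real (wmeas p w B)"

definition CMO_term :: "nat \<Rightarrow> (padic ^ 'n \<Rightarrow> real) \<Rightarrow> real \<Rightarrow> (padic ^ 'n \<Rightarrow> complex) \<Rightarrow> int \<Rightarrow> real" where
  "CMO_term p w r b \<gamma> =
     ((LINT x : Bg p \<gamma> | haar p. cmod (b x - wmean p w (Bg p \<gamma>) b) powr r * w x)
       / wmeas p w (Bg p \<gamma>)) powr (1 / r)"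

definition CMO_space :: "nat \<Rightarrow> (padic ^ 'n \<Rightarrow> real) \<Rightarrow> real \<Rightarrow> (padic ^ 'n \<Rightarrow> complex) set" where
  "CMO_space p w r = {b. b \<in> borel_measurable (haar p) \<and>
      (\<forall>\<gamma>. set_integrable (haar p) (Bg p \<gamma>) (\<lambda>x. cmod (b x) powr r * w x)) \<and>
      bdd_above (range (CMO_term p w r b))}"

text \<open>Omega in L^s(S_0) (s = q' in (1, oo]); s = oo encoded by the flag\<close>
definition Lq_S0 :: "nat \<Rightarrow> real \<Rightarrow> (padic ^ 'n \<Rightarrow> complex) \<Rightarrow> bool" where
  "Lq_S0 p q \<Omega> \<longleftrightarrow> \<Omega> \<in> borel_measurable (haar p) \<and>
     (if q = 1 then (\<exists>M. AE y in haar p. y \<in> Sg p 0 \<longrightarrow> cmod (\<Omega> y) \<le> M)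
      else set_integrable (haar p) (Sg p 0) (\<lambda>y. cmod (\<Omega> y) powr (q / (q - 1))))"

definition Hcomm :: "nat \<Rightarrow> nat \<Rightarrow> (padic \<Rightarrow> real) \<Rightarrow> (padic ^ 'n \<Rightarrow> complex)
     \<Rightarrow> (nat \<Rightarrow> padic ^ 'n \<Rightarrow> complex) \<Rightarrow> (nat \<Rightarrow> padic ^ 'n \<Rightarrow> complex) \<Rightarrow> padic ^ 'n \<Rightarrow> complex" where
  "Hcomm p m \<Phi> \<Omega> b f x = (\<Sum>\<^sub>\<infinity>\<gamma>::int.
      complex_of_real (\<Phi> (ppow \<gamma>) / real p powr real_of_int \<gamma>) *
      (LINT y : Sg p 0 | haar p. \<Omega> y *
          (\<Prod>i\<in>{1..m}. b i x - b i (pdil \<gamma> x y)) *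
          (\<Prod>i\<in>{1..m}. f i (pdil \<gamma> x y))))"

end

theory Submission
  imports Defs
begin

text \<open>Everything is estimated on the shells \<open>S\<^sub>a\<close>. For \<open>x \<in> S\<^sub>a\<close> and \<open>y \<in> S\<^sub>0\<close> the point
  \<open>z = p\<^sup>\<gamma>|x|\<^sup>-\<^sup>1y\<close> runs through \<open>S\<^sub>k\<close> with \<open>k = a - \<gamma>\<close>, and comparing the means of \<open>b\<^sub>i\<close> over
  \<open>B\<^sub>a\<close> and \<open>B\<^sub>k\<close> gives
  \<open>|b\<^sub>i(x) - b\<^sub>i(z)| \<le> C\<^sub>i (2 + p\<^bsup>n\<zeta>|\<gamma>|\<^esup>) (1 + U\<^sub>i\<^sub>,\<^sub>a(x)) (1 + U\<^sub>i\<^sub>,\<^sub>k(z))\<close>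
  with normalised oscillations \<open>U\<close>. The \<open>x\<close>-dependence thus factors out of the integral over \<open>y\<close>, and
  what remains is bounded by \<open>W(B\<^sub>k)\<^sup>\<lambda>\<close> times the norms, since the \<open>A\<^sub>\<zeta>\<close> condition turns weighted
  averages into unweighted ones at the cost of the factor \<open>\<zeta>\<close> in the exponents. Summing over \<open>\<gamma>\<close>
  is then pointwise in \<open>x\<close>, with no need of Minkowski's inequality, and yields
  \<open>|H(x)| \<le> K W(B\<^sub>a)\<^sup>\<lambda> \<Prod>(1 + U\<^sub>i\<^sub>,\<^sub>a(x))\<close> on \<open>S\<^sub>a\<close>. The \<open>L\<^sup>q\<close> norms over the shells inside a ball
  form a geometric series because \<open>1 + q\<lambda> > 0\<close> and the weight satisfies a reverse doubling condition.\<close>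

section \<open>Digits, balls and shells\<close>

text \<open>Hoelder's inequality is replaced throughout by Young-type bounds whose right-hand sides
  are sums. These are not homogeneous, so every function is first scaled until its weighted power
  integral over \<open>B_k\<close> is at most \<open>W(B_k)\<close>: the oscillation of
  \<open>b_i\<close> is divided by a constant \<open>C_i\<close>, and \<open>f_i\<close> by
  \<open>N_i W(B_k)^lambda_i\<close>. The constants are then independent of \<open>k\<close>, and
  the scale survives only in the factor \<open>W(B_k)^lambda\<close>. Since lambda is negative, this
  factor calls for lower bounds of \<open>W(B_k)\<close> in terms of \<open>W(B_a)\<close>. For
  \<gamma> \<ge> 0 the ball \<open>B_k\<close> is the smaller one and doubling gives the exponent
  \<zeta>; for \<gamma> < 0 it is the larger one and the reverse Hoelder condition gives the
  exponent (\<delta>-1)/\<delta>. This is the origin of the two series in the hypothesis. Their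
  factors (2 + ...)^m come from the drift of the means of \<open>b_i\<close> between the two balls.
  The inner integral over \<open>y\<close> is unweighted, so there the integrability exponents drop
  from \<open>r_i\<close>, \<open>q_i\<close> to \<open>r_i/\<zeta>\<close>,
  \<open>q_i/\<zeta>\<close>; the exponent hypothesis ensures that \<open>q\<close> times the sum of
  their reciprocals is at most 1.\<close>

lemma powr_int_floor_ex:
  assumes "1 < (p::real)" "0 < (t::real)"
  obtains j :: int where "p powr j \<le> t" "t < p powr (j + 1)"
proof
  let ?j = "\<lfloor>log p t\<rfloor>"
  show "p powr ?j \<le> t" 
    using assms by (subst le_log_iff[symmetric]) (auto simp: of_int_floor_le)
  show "t < p powr (?j + 1)"
    using assms by (subst log_less_iff[symmetric]) linarith+
qed

lemma pdigits_less: "0 < p \<Longrightarrow> pdigits p t k < p"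
  by (simp add: pdigits_def nat_less_iff)

lemma pdigits_eq_0:
  fixes g :: int
  assumes "0 < p" "0 \<le> t" "t < real p powr g" "k < - g"
  shows "pdigits p t k = 0"
proof -
  have "t * real p powr real_of_int (k + 1) < real p powr g * real p powr (k + 1)"
    using assms by (intro mult_strict_right_mono) auto
  also have "\<dots> = real p powr (g + (k + 1))"
    by (simp add: powr_add)
  also have "\<dots> \<le> real p powr 0"
    using assms by (intro powr_mono) linarith+
  finally have "t * real p powr real_of_int (k + 1) < 1" using assms by simp
  then have "\<lfloor>t * real p powr real_of_int (k + 1)\<rfloor> = 0"
    using assms by (intro floor_unique) auto
  then show ?thesis by (simp add: pdigits_def)
qed

text \<open>The digit with index \<open>k\<close> is the coefficient of \<open>p^(-k-1)\<close> in
  the base-p expansion of \<open>t\<close>, so the order of places is reversed and smallness of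
  \<open>t\<close> means vanishing of the digits of low index. Balls around 0 thus pull back to
  half-open cubes.\<close>

lemma pdigits_eq_0_iff:
  fixes g :: int
  assumes "1 < p" "0 \<le> t"
  shows "(\<forall>k < - g. pdigits p t k = 0) \<longleftrightarrow> t < real p powr g"
proof
  assume *: "\<forall>k < - g. pdigits p t k = 0"
  show "t < real p powr g"
  proof (rule ccontr)
    assume "\<not> t < real p powr g"
    then have t: "real p powr g \<le> t" by simp
    moreover have "0 < real p powr g" using assms by simp
    ultimately have "0 < t" by linarith
    then obtain j :: int where j: "real p powr j \<le> t" "t < real p powr (j + 1)"
      using powr_int_floor_ex[of "real p" t] assms by auto
    have "real p powr g < real p powr (j + 1)" using t j by linarith
    then have "g \<le> j" using assms by (simp add: powr_less_cancel_iff)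
    \<comment> \<open>Rescaling puts \<open>t\<close> into [1,p), so the floor of \<open>u\<close>
      is the leading base-p digit of \<open>t\<close>; it has index \<open>-j-1\<close> and is not
      0.\<close>
    define u where "u = t * real p powr real_of_int (- j)"
    have "real p powr j * real p powr (- j) \<le> u"
      using j assms unfolding u_def by (intro mult_right_mono) auto
    then have u1: "1 \<le> u" using assms by (simp add: powr_add[symmetric])
    have "u < real p powr (j + 1) * real p powr (- j)"
      using j assms unfolding u_def by (simp add: mult_strict_right_mono)
    then have u2: "u < p" using assms by (simp add: powr_add[symmetric])
    have "1 \<le> \<lfloor>u\<rfloor>" "\<lfloor>u\<rfloor> < p" using u1 u2 by (auto simp: floor_less_iff)
    moreover have "pdigits p t (- j - 1) = nat (\<lfloor>u\<rfloor> mod int p)"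
      by (simp add: pdigits_def u_def)
    ultimately have "pdigits p t (- j - 1) \<noteq> 0" by simp
    then show False using * \<open>g \<le> j\<close> by auto
  qed
qed (use assms pdigits_eq_0[of p t g] in auto)

lemma pdigits_in_qp:
  assumes "1 < p" "0 \<le> t"
  shows "pdigits p t \<in> qp p"
proof -
  obtain g :: int where g: "t < real p powr g"
  proof (cases "t = 0")
    case True then show ?thesis using that[of 0] assms by auto
  next
    case False 
    then obtain j :: int where j: "t < real p powr (j + 1)"
      using powr_int_floor_ex[of "real p" t] assms by auto
    then show ?thesis using that[of "j+1"] by simp
  qed
  then have "\<forall>k < - g. pdigits p t k = 0" using pdigits_eq_0_iff assms by blast
  then show ?thesis using assms by (auto simp: qp_def pdigits_less)
qed

text \<open>Because the places are reversed, multiplication by \<open>p^k\<close> becomes division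
  by \<open>p^k\<close> on the real side. The scaling of Haar measure is thereby reduced to that of
  Lebesgue measure.\<close>

lemma pshift_pdigits:
  "0 < p \<Longrightarrow> pshift k (pdigits p t) = pdigits p (real p powr (- k) * t)"
proof -
  assume "0 < p"
  then have "real p powr real_of_int (j - k + 1) = real p powr (- k) * real p powr real_of_int (j + 1)" for j
    by (simp add: powr_add[symmetric] algebra_simps)
  then show ?thesis by (simp add: pshift_def pdigits_def fun_eq_iff mult_ac)
qed

text \<open>\<open>LEAST\<close> over the integers is meaningful only when the candidates are
  bounded below. The digits vanish below some \<open>N\<close>, so the search can start there and
  run over the naturals.\<close>

lemma least_nonzero_digit:
  assumes "a \<in> qp p" "a \<noteq> pzero"
  obtains j where "(LEAST k. a k \<noteq> 0) = j" "a j \<noteq> 0" "\<And>k. k < j \<Longrightarrow> a k = 0"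
proof -
  obtain N where N: "\<forall>k<N. a k = 0" using assms by (auto simp: qp_def)
  obtain i where i: "a i \<noteq> 0" using assms by (auto simp: pzero_def)
  define n where "n = (LEAST n::nat. a (N + int n) \<noteq> 0)"
  have "N \<le> i" using N i by (meson not_le)
  then have ex: "a (N + int (nat (i - N))) \<noteq> 0" using i by simp
  have n: "a (N + int n) \<noteq> 0" unfolding n_def by (rule LeastI) (rule ex)
  have lt: "a k = 0" if "k < N + int n" for k
  proof (rule ccontr)
    assume "a k \<noteq> 0"
    then have "N \<le> k" using N by (meson not_le)
    then have "a (N + int (nat (k - N))) \<noteq> 0" using \<open>a k \<noteq> 0\<close> by simp
    then have "n \<le> nat (k - N)" unfolding n_def by (rule Least_le)
    then show False using that \<open>N \<le> k\<close> by linarith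
  qed
  have "(LEAST k. a k \<noteq> 0) = N + int n"
    by (rule Least_equality) (use n lt in \<open>auto simp: not_less[symmetric]\<close>)
  then show ?thesis using that n lt by blast
qed

lemma pnorm_le_iff:
  fixes g :: int
  assumes "1 < p" "a \<in> qp p"
  shows "pnorm p a \<le> real p powr g \<longleftrightarrow> (\<forall>k < - g. a k = 0)"
proof (cases "a = pzero")
  case True then show ?thesis by (auto simp: pnorm_def pdist_def pzero_def)
next
  case False
  then obtain j where j: "(LEAST k. a k \<noteq> 0) = j" "a j \<noteq> 0" "\<And>k. k < j \<Longrightarrow> a k = 0"
    using least_nonzero_digit assms by metis
  then have "pnorm p a = real p powr (- j)" using False by (simp add: pnorm_def pdist_def pzero_def)
  then have "pnorm p a \<le> real p powr g \<longleftrightarrow> - g \<le> j" using assms by auto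
  also have "\<dots> \<longleftrightarrow> (\<forall>k < - g. a k = 0)" using j by (meson le_less_linear not_le order.strict_trans2)
  finally show ?thesis .
qed

lemma pnorm_cases:
  obtains "pnorm p a = 0" | j :: int where "pnorm p a = real p powr j"
proof (cases "a = pzero")
  case True then show ?thesis using that by (simp add: pnorm_def pdist_def)
next
  case False then show ?thesis 
    using that(2)[of "- (LEAST k. a k \<noteq> pzero k)"] by (simp add: pnorm_def pdist_def)
qed

lemma pnormn_cases:
  fixes x :: "padic ^ 'n"
  obtains "pnormn p x = 0" | j :: int where "pnormn p x = real p powr j"
proof -
  have "pnormn p x \<in> range (\<lambda>i. pnorm p (x $ i))" unfolding pnormn_def by (rule Max_in) auto
  then obtain i where "pnormn p x = pnorm p (x $ i)" by auto
  then show ?thesis using pnorm_cases[of p "x $ i"] that by metis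
qed

lemma Bg_iff:
  fixes x :: "padic ^ 'n"
  assumes "1 < p"
  shows "x \<in> Bg p g \<longleftrightarrow> x \<in> qpn p \<and> (\<forall>i. \<forall>k < - g. (x $ i) k = 0)"
proof -
  have "pnormn p x \<le> c \<longleftrightarrow> (\<forall>i. pnorm p (x $ i) \<le> c)" for c
    unfolding pnormn_def by (subst Max_le_iff) auto
  then show ?thesis using assms by (auto simp: Bg_def qpn_def pnorm_le_iff)
qed

text \<open>The norm takes no values other than 0 and integral powers of \<open>p\<close>, so
  nothing lies strictly between the radii of exponent \<open>g - 1\<close> and
  \<open>g\<close>.\<close>

lemma Sg_eq_Bg_diff:
  assumes "1 < p"
  shows "(Sg p g :: (padic ^ 'n) set) = Bg p g - Bg p (g - 1)"
proof -
  have "pnormn p x = real p powr g \<longleftrightarrow> pnormn p x \<le> real p powr g \<and> \<not> pnormn p x \<le> real p powr (g - 1)"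
    (is "?L \<longleftrightarrow> ?R") for x :: "padic ^ 'n"
  proof (cases rule: pnormn_cases[of p x])
    case 1 then show ?thesis using assms by auto
  next
    case (2 j) 
    have "real p powr j = real p powr g \<longleftrightarrow> j = g" using assms by (simp add: powr_inj)
    moreover have "real p powr j \<le> real p powr g \<longleftrightarrow> j \<le> g" using assms by simp
    moreover have "real p powr j \<le> real p powr (g - 1) \<longleftrightarrow> j \<le> g - 1" 
      using assms by (simp add: le_diff_eq) linarith
    moreover have "j = g \<longleftrightarrow> j \<le> g \<and> \<not> j \<le> g - 1" by linarith
    ultimately show ?thesis unfolding 2 by simp
  qed
  then show ?thesis by (auto simp: Sg_def Bg_def)
qed

lemma Bg_mono: "1 < p \<Longrightarrow> g \<le> h \<Longrightarrow> Bg p g \<subseteq> Bg p h"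
  by (auto simp: Bg_iff)

lemma Sg_subset_Bg: "Sg p g \<subseteq> Bg p g"
  by (auto simp: Sg_def Bg_def)

lemma Bg_eq_pball: "Bg p g = pball p (\<chi> i. pzero) g"
  by (simp add: Bg_def pball_def pnormn_def pdistn_def pnorm_def)

lemma is_pball_Bg: "1 < p \<Longrightarrow> is_pball p (Bg p g)"
  unfolding is_pball_def Bg_eq_pball
  by (intro bexI[of _ "\<chi> i. pzero"]) (auto simp: qpn_def qp_def pzero_def)

lemma pvaln_Sg:
  fixes x :: "padic ^ 'n"
  assumes "1 < p" "x \<in> Sg p g"
  shows "pvaln x = - g"
proof -
  have x: "x \<in> Bg p g" "x \<notin> Bg p (g - 1)" using assms by (auto simp: Sg_eq_Bg_diff)
  have lt: "(x $ i) k = 0" if "k < - g" for i k using x that assms by (auto simp: Bg_iff)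
  obtain i k where ik: "k < - (g - 1)" "(x $ i) k \<noteq> 0" using x assms by (auto simp: Bg_iff)
  have "k = - g" using ik lt by (metis diff_minus_eq_add minus_diff_eq neqE uminus_add_conv_diff zless_add1_eq add.commute)
  then show ?thesis unfolding pvaln_def using ik lt
    by (intro Least_equality) (auto simp: not_less[symmetric])
qed

lemma pshiftn_mem_qpn: "pshiftn k x \<in> qpn p \<longleftrightarrow> x \<in> qpn p"
proof -
  have "pshift k a \<in> qp p \<longleftrightarrow> a \<in> qp p" for a
  proof
    assume "pshift k a \<in> qp p"
    then obtain N where "\<forall>j. a (j - k) < p" "\<forall>j<N. a (j - k) = 0" by (auto simp: qp_def pshift_def)
    then have "a j < p" "j < N - k \<Longrightarrow> a j = 0" for j
      by (metis add_diff_cancel_right', metis add_diff_cancel_right' less_diff_eq)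
    then show "a \<in> qp p" by (auto simp: qp_def)
  next
    assume "a \<in> qp p"
    then obtain N where "\<forall>j. a j < p" "\<forall>j<N. a j = 0" by (auto simp: qp_def)
    then show "pshift k a \<in> qp p" by (auto simp: qp_def pshift_def intro!: exI[of _ "N + k"])
  qed
  then show ?thesis by (simp add: qpn_def pshiftn_def)
qed

lemma pshiftn_mem_Bg: "1 < p \<Longrightarrow> pshiftn k x \<in> Bg p g \<longleftrightarrow> x \<in> Bg p (g + k)"
proof -
  assume p: "1 < p"
  have "(\<forall>j < - g. a (j - k) = 0) \<longleftrightarrow> (\<forall>j < - (g + k). a j = 0)" for a :: padic
    by auto (metis add_diff_cancel_right' diff_conv_add_uminus less_diff_eq)
  then show ?thesis using p by (simp add: Bg_iff pshiftn_mem_qpn) (simp add: pshiftn_def pshift_def)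
qed

lemma pshiftn_mem_Sg: "1 < p \<Longrightarrow> pshiftn k x \<in> Sg p g \<longleftrightarrow> x \<in> Sg p (g + k)"
  by (simp add: Sg_eq_Bg_diff pshiftn_mem_Bg algebra_simps)

text \<open>On one shell the dilation depends on \<open>x\<close> only through \<open>a\<close>.
  This freezes the change of variables and leaves \<open>x\<close> only in the factors
  \<open>b i x\<close>.\<close>

lemma pdil_Sg:
  assumes "1 < p" "x \<in> Sg p a"
  shows "pdil g x y = pshiftn (g - a) y"
  using pvaln_Sg[OF assms] by (simp add: pdil_def)

section \<open>Haar measure\<close>

text \<open>\<open>measure_of\<close> retains the prescribed set function only if it is a measure on
  the generated sigma-algebra. Complements are taken within the orthant, whose measurability follows
  from closedness.\<close>

lemma haar_sigma_algebra:
  "sigma_algebra UNIV {A :: (padic ^ 'n) set. pdigitsn p -` A \<inter> orthant \<in> sets (lebesgue :: (real ^ 'n) measure)}"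
  (is "sigma_algebra _ ?A")
proof -
  have "closed (orthant :: (real ^ 'n) set)"
    unfolding orthant_def Collect_all_eq by (intro closed_INT ballI closed_Collect_le continuous_intros)
  then have o: "(orthant :: (real ^ 'n) set) \<in> sets lebesgue" by auto
  show ?thesis
    unfolding sigma_algebra_iff2
  proof (safe)
    fix A :: "(padic ^ 'n) set" assume "pdigitsn p -` A \<inter> orthant \<in> sets (lebesgue :: (real ^ 'n) measure)"
    moreover have "pdigitsn p -` (UNIV - A) \<inter> orthant = orthant - (pdigitsn p -` A \<inter> orthant)" by auto
    ultimately show "pdigitsn p -` (UNIV - A) \<inter> orthant \<in> sets (lebesgue :: (real ^ 'n) measure)"
      using o by auto
  next
    fix A :: "nat \<Rightarrow> (padic ^ 'n) set" assume "range A \<subseteq> ?A"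
    then have "(\<Union>i. pdigitsn p -` A i \<inter> orthant) \<in> sets (lebesgue :: (real ^ 'n) measure)"
      by (intro sets.countable_UN) auto
    then show "pdigitsn p -` (\<Union> (range A)) \<inter> orthant \<in> sets (lebesgue :: (real ^ 'n) measure)"
      by (simp add: vimage_UN Int_UN_distrib2)
  qed auto
qed

lemma space_haar [simp]: "space (haar p) = UNIV"
  by (simp add: haar_def)

lemma sets_haar_iff: "A \<in> sets (haar p) \<longleftrightarrow> pdigitsn p -` A \<inter> orthant \<in> sets lebesgue"
  unfolding haar_def using sigma_algebra.sets_measure_of_eq[OF haar_sigma_algebra] by auto

lemma emeasure_haar:
  fixes A :: "(padic ^ 'n) set"
  assumes "A \<in> sets (haar p)"
  shows "emeasure (haar p) A = emeasure lebesgue (pdigitsn p -` A \<inter> orthant)"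
  unfolding haar_def
proof (rule emeasure_measure_of_sigma[OF haar_sigma_algebra])
  let ?A = "{A :: (padic ^ 'n) set. pdigitsn p -` A \<inter> orthant \<in> sets (lebesgue :: (real ^ 'n) measure)}"
  show "positive ?A (\<lambda>A. emeasure lebesgue (pdigitsn p -` A \<inter> orthant))"
    by (simp add: positive_def)
  show "countably_additive ?A (\<lambda>A. emeasure lebesgue (pdigitsn p -` A \<inter> orthant))"
    unfolding countably_additive_def
  proof safe
    fix A :: "nat \<Rightarrow> (padic ^ 'n) set" assume "range A \<subseteq> ?A" "disjoint_family A"
    then have "(\<Sum>i. emeasure lebesgue (pdigitsn p -` A i \<inter> orthant)) 
      = emeasure lebesgue (\<Union>i. pdigitsn p -` A i \<inter> orthant)"
      by (intro suminf_emeasure) (auto simp: disjoint_family_on_def)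
    then show "(\<Sum>i. emeasure lebesgue (pdigitsn p -` A i \<inter> orthant)) 
      = emeasure lebesgue (pdigitsn p -` (\<Union> (range A)) \<inter> orthant)"
      by (simp add: vimage_UN Int_UN_distrib2)
  qed
  show "A \<in> ?A" using assms sets_haar_iff by auto
qed

text \<open>Completeness is inherited from \<open>lebesgue\<close>. It settles measurability on the
  points outside all shells, where nothing is known about the commutator.\<close>

lemma null_subset_haar:
  assumes "B \<in> null_sets (haar p)" "A \<subseteq> B"
  shows "A \<in> null_sets (haar p)"
proof -
  have B: "pdigitsn p -` B \<inter> orthant \<in> null_sets lebesgue"
    using assms(1) by (auto simp: null_sets_def sets_haar_iff emeasure_haar)
  have "pdigitsn p -` A \<inter> orthant \<in> null_sets lebesgue"
    by (rule null_sets_completion_subset[OF _ B]) (use assms(2) in auto)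
  then show ?thesis by (auto simp: null_sets_def sets_haar_iff emeasure_haar)
qed

lemma vimage_Bg:
  assumes "1 < p"
  shows "pdigitsn p -` Bg p g \<inter> orthant = {t :: real ^ 'n. \<forall>i. 0 \<le> t $ i \<and> t $ i < real p powr g}"
  using assms by (auto simp: Bg_iff qpn_def pdigitsn_def orthant_def pdigits_in_qp pdigits_eq_0_iff)

lemma Bg_sets [measurable]: "1 < p \<Longrightarrow> (Bg p g :: (padic ^ 'n) set) \<in> sets (haar p)"
proof -
  assume "1 < p"
  have "{t :: real ^ 'n. \<forall>i. 0 \<le> t $ i \<and> t $ i < real p powr g} \<in> sets borel" by measurable
  then show ?thesis using \<open>1 < p\<close> by (simp add: sets_haar_iff vimage_Bg)
qed

lemma Sg_sets [measurable]: "1 < p \<Longrightarrow> (Sg p g :: (padic ^ 'n) set) \<in> sets (haar p)"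
  by (simp add: Sg_eq_Bg_diff Bg_sets sets.Diff)

lemma emeasure_Bg:
  assumes "1 < p"
  shows "emeasure (haar p) (Bg p g :: (padic ^ 'n) set) = ennreal (real p powr (real CARD('n) * g))"
proof -
  let ?X = "{t :: real ^ 'n. \<forall>i. 0 \<le> t $ i \<and> t $ i < real p powr g}"
  let ?c = "\<chi> i. real p powr g :: real ^ 'n"
  have X: "?X \<in> sets lebesgue" using Bg_sets[OF assms, of g] by (simp add: sets_haar_iff vimage_Bg assms)
  have le: "\<forall>b\<in>Basis. (0::real^'n) \<bullet> b \<le> ?c \<bullet> b" by (auto simp: Basis_vec_def inner_axis)
  have prod: "(\<Prod>b\<in>Basis. (?c - 0) \<bullet> b) = real p powr (real CARD('n) * g)"
  proof -
    have "(\<Prod>b\<in>Basis. (?c - 0) \<bullet> b) = (\<Prod>b\<in>(Basis :: (real^'n) set). real p powr g)"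
      by (intro prod.cong) (auto simp: Basis_vec_def inner_axis)
    also have "\<dots> = (real p powr g) ^ CARD('n)" by simp
    also have "\<dots> = real p powr (real CARD('n) * g)" using assms 
      by (subst powr_realpow[symmetric]) (simp_all add: powr_powr mult.commute)
    finally show ?thesis .
  qed
  \<comment> \<open>The half-open cube is squeezed between the open and the closed box, which have
    the same volume.\<close>
  have "emeasure lebesgue (box 0 ?c) \<le> emeasure lebesgue ?X" using X
    by (intro emeasure_mono) (auto simp: box_def Basis_vec_def inner_axis less_imp_le)
  moreover have "emeasure lebesgue ?X \<le> emeasure lebesgue (cbox 0 ?c)" 
    by (intro emeasure_mono) (auto simp: cbox_def Basis_vec_def inner_axis less_imp_le)
  ultimately have "emeasure lebesgue ?X = ennreal (real p powr (real CARD('n) * g))"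
    using prod le by (simp add: emeasure_lborel_cbox_eq emeasure_lborel_box_eq)
  then show ?thesis using assms by (simp add: emeasure_haar Bg_sets vimage_Bg)
qed

text \<open>The space of \<open>haar\<close> consists of all vectors of digit functions, including
  those outside \<open>qpn p\<close>. The digit map sends every point of the orthant into some ball,
  so the preimage of the complement is empty.\<close>

lemma UN_Bg_null:
  assumes "1 < p"
  shows "- (\<Union>g. Bg p g :: (padic ^ 'n) set) \<in> null_sets (haar p)"
proof -
  have "t \<in> (\<Union>g. pdigitsn p -` Bg p g)" if t: "t \<in> orthant" for t :: "real ^ 'n"
  proof -
    define s where "s = 1 + Max (range (\<lambda>i. t $ i))"
    have le: "t $ i \<le> Max (range (\<lambda>i. t $ i))" for i by (rule Max_ge) auto
    then have s: "t $ i < s" for i by (smt (verit) s_def)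
    moreover have "0 \<le> t $ i" for i using t by (auto simp: orthant_def)
    ultimately have "0 < s" by (meson le_less_trans)
    then obtain j :: int where j: "s < real p powr (j + 1)"
      using powr_int_floor_ex[of "real p" s] assms by auto
    have "t \<in> {t. \<forall>i. 0 \<le> t $ i \<and> t $ i < real p powr (j+1)}" 
      using t j s by (auto simp: orthant_def intro: less_trans)
    also have "\<dots> = pdigitsn p -` Bg p (j + 1) \<inter> orthant" by (rule vimage_Bg[OF assms, symmetric])
    finally show ?thesis by blast
  qed
  then have *: "pdigitsn p -` (- (\<Union>g. Bg p g :: (padic ^ 'n) set)) \<inter> orthant = {}" by blast
  have "- (\<Union>g. Bg p g :: (padic ^ 'n) set) \<in> sets (haar p)" unfolding sets_haar_iff * by (rule sets.empty_sets)
  from emeasure_haar[OF this] this show ?thesis unfolding * by (metis emeasure_empty null_setsI)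
qed

lemma sigma_finite_haar:
  assumes "1 < p"
  shows "sigma_finite_measure (haar p :: (padic ^ 'n) measure)"
proof
  let ?A = "insert (- (\<Union>g. Bg p g)) (range (\<lambda>g. Bg p g :: (padic ^ 'n) set))"
  have "countable ?A" by simp
  moreover have "?A \<subseteq> sets (haar p)" using assms UN_Bg_null[OF assms] by (auto simp: Bg_sets)
  moreover have "\<Union>?A = space (haar p)" by auto
  moreover have "\<forall>a\<in>?A. emeasure (haar p) a \<noteq> \<infinity>" 
    using assms null_setsD1[OF UN_Bg_null[OF assms]] 
    by (metis emeasure_Bg ennreal_neq_top image_iff infinity_ennreal_def insert_iff ennreal_zero_neq_top)
  ultimately show "\<exists>A. countable A \<and> A \<subseteq> sets (haar p) \<and> \<Union>A = space (haar p :: (padic ^ 'n) measure) \<and> (\<forall>a\<in>A. emeasure (haar p) a \<noteq> \<infinity>)"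
    by blast
qed

lemma INT_Bg_null:
  assumes "1 < p"
  shows "(\<Inter>g. Bg p g :: (padic ^ 'n) set) \<in> null_sets (haar p)"
proof -
  let ?I = "(\<Inter>g. Bg p g :: (padic ^ 'n) set)"
  have I: "?I \<in> sets (haar p)" using assms by (intro sets.countable_INT) (auto simp: Bg_sets)
  have le: "emeasure (haar p) ?I \<le> ennreal e" if e: "0 < e" for e
  proof -
    obtain j :: int where j: "real p powr j \<le> e" 
      using powr_int_floor_ex[of "real p" e] assms e by auto
    \<comment> \<open>For \<open>k\<close> at most 0 and dimension at least 1, the dimension times
      \<open>k\<close> is at most \<open>k\<close>, hence at most \<open>j\<close>.\<close>
    define k where "k = min j 0"
    have "emeasure (haar p) ?I \<le> emeasure (haar p) (Bg p k :: (padic ^ 'n) set)"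
      using assms by (intro emeasure_mono) (auto simp: Bg_sets)
    also have "\<dots> = ennreal (real p powr (real CARD('n) * k))" using assms by (simp add: emeasure_Bg)
    also have "real p powr (real CARD('n) * k) \<le> real p powr j"
    proof (intro powr_mono)
      have "real CARD('n) * real_of_int k \<le> 1 * real_of_int k" unfolding k_def 
        by (intro mult_right_mono_neg) (auto simp: Suc_leI)
      then show "real CARD('n) * real_of_int k \<le> real_of_int j" by (simp add: k_def)
    qed (use assms in auto)
    finally show ?thesis using j by (meson ennreal_leI order_trans)
  qed
  have "emeasure (haar p) ?I \<le> 0"
    by (rule ennreal_le_epsilon, unfold add_0, rule le)
  then show ?thesis using I by (auto simp: null_sets_def)
qed

text \<open>A point of a ball that avoids every shell descends through all smaller balls; apart from
  points in no ball, only the origin is missed.\<close>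

lemma UN_Sg: 
  assumes "1 < p"
  shows "- (\<Union>g. Sg p g) \<subseteq> - (\<Union>g. Bg p g) \<union> (\<Inter>g. Bg p g :: (padic ^ 'n) set)"
proof -
  have "x \<in> (\<Inter>g. Bg p g)" if x: "x \<in> Bg p g" "x \<notin> (\<Union>g. Sg p g)" for x :: "padic ^ 'n" and g
  proof -
    have down: "x \<in> Bg p (g - int n)" for n
    proof (induction n)
      case (Suc n)
      have "x \<notin> Sg p (g - int n)" using x by blast
      then have "x \<in> Bg p (g - int n - 1)" using Suc assms by (auto simp: Sg_eq_Bg_diff)
      then show ?case by (simp add: algebra_simps)
    qed (use x in simp)
    show ?thesis
    proof
      fix h
      have "x \<in> Bg p (g - int (nat (g - h)))" by (rule down)
      moreover have "g - int (nat (g - h)) \<le> h" by linarith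
      ultimately show "x \<in> Bg p h" using Bg_mono[OF assms] by blast
    qed
  qed
  then show ?thesis by blast
qed

lemma UN_Sg_null: "1 < p \<Longrightarrow> - (\<Union>g. Sg p g :: (padic ^ 'n) set) \<in> null_sets (haar p)"
  by (rule null_subset_haar[OF null_sets.Un[OF UN_Bg_null INT_Bg_null] UN_Sg])

lemma AE_UN_Sg: "1 < p \<Longrightarrow> AE x in haar p. x \<in> (\<Union>g. Sg p g)"
  by (rule AE_I'[OF UN_Sg_null]) auto

text \<open>The digit map turns the shift into a homothety. The vacuous translation
  \<open>+ 0\<close> gives the image the affine form to which the transformation rule for Lebesgue
  measure applies.\<close>

lemma pshiftn_vimage:
  fixes A :: "(padic ^ 'n) set"
  assumes "0 < p"
  shows "pdigitsn p -` (pshiftn k -` A) \<inter> orthant = (\<lambda>t. real p powr k *\<^sub>R t + 0) ` (pdigitsn p -` A \<inter> orthant)"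
    (is "?L = ?R")
proof -
  have s: "pshiftn k (pdigitsn p t) = pdigitsn p (real p powr (- k) *\<^sub>R t)" for t :: "real ^ 'n"
    using assms by (simp add: pshiftn_def pdigitsn_def vec_eq_iff pshift_pdigits)
  have o: "c *\<^sub>R t \<in> orthant \<longleftrightarrow> t \<in> orthant" if "0 < c" for c and t :: "real ^ 'n"
    using that by (auto simp: orthant_def zero_le_mult_iff)
  have inv: "real p powr k * real p powr (- k) = 1" using assms by (simp add: powr_add[symmetric])
  have R: "t \<in> ?R \<longleftrightarrow> real p powr (- k) *\<^sub>R t \<in> pdigitsn p -` A \<inter> orthant" for t
  proof
    assume "t \<in> ?R"
    then obtain u where "u \<in> pdigitsn p -` A \<inter> orthant" "t = real p powr k *\<^sub>R u" by auto
    then show "real p powr (- k) *\<^sub>R t \<in> pdigitsn p -` A \<inter> orthant"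
      using inv by (simp add: mult.commute)
  next
    assume "real p powr (- k) *\<^sub>R t \<in> pdigitsn p -` A \<inter> orthant"
    then show "t \<in> ?R" using inv
      by (intro image_eqI[of _ _ "real p powr (- k) *\<^sub>R t"]) auto
  qed
  have L: "t \<in> ?L \<longleftrightarrow> real p powr (- k) *\<^sub>R t \<in> pdigitsn p -` A \<inter> orthant" for t
    using o[of "real p powr (- k)" t] assms by (simp add: s)
  show ?thesis by (rule set_eqI) (rule trans[OF L R[symmetric]])
qed

lemma measurable_pshiftn:
  assumes "0 < p"
  shows "pshiftn k \<in> measurable (haar p) (haar p :: (padic ^ 'n) measure)"
proof (rule measurableI)
  fix A :: "(padic ^ 'n) set" assume A: "A \<in> sets (haar p)"
  have "(\<lambda>t. real p powr k *\<^sub>R t + 0) ` S = (*\<^sub>R) (real p powr (- k)) -` S \<inter> space lebesgue" for S :: "(real ^ 'n) set"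
  proof -
    have "real p powr k * real p powr (- k) = 1" using assms by (simp add: powr_add[symmetric])
    then show ?thesis 
      by (auto simp: image_iff mult.commute intro!: bexI[of _ "real p powr (- k) *\<^sub>R _"])
  qed
  moreover have "(*\<^sub>R) (real p powr (- k)) -` (pdigitsn p -` A \<inter> orthant) \<inter> space lebesgue \<in> sets (lebesgue :: (real ^ 'n) measure)"
    using A by (intro measurable_sets[OF lebesgue_measurable_scaling]) (simp add: sets_haar_iff)
  ultimately show "pshiftn k -` A \<inter> space (haar p) \<in> sets (haar p)"
    unfolding sets_haar_iff using pshiftn_vimage[OF assms, of k A] by simp
qed auto

text \<open>A preimage under multiplication by \<open>p^k\<close> is the set multiplied by
  \<open>p^(-k)\<close>, which stretches norms by the factor \<open>p^k\<close>; the density is this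
  factor to the power of the dimension.\<close>

lemma distr_pshiftn:
  assumes "0 < p"
  shows "distr (haar p) (haar p) (pshiftn k) 
    = density (haar p :: (padic ^ 'n) measure) (\<lambda>_. ennreal (real p powr (real CARD('n) * k)))"
proof (rule measure_eqI)
  fix A :: "(padic ^ 'n) set" assume "A \<in> sets (distr (haar p) (haar p) (pshiftn k))"
  then have A: "A \<in> sets (haar p)" by simp
  have sA: "pshiftn k -` A \<in> sets (haar p)" using measurable_sets[OF measurable_pshiftn[OF assms] A] by simp
  have "emeasure (haar p) (pshiftn k -` A) = \<bar>real p powr k\<bar> ^ DIM(real ^ 'n) * emeasure (haar p) A"
    unfolding emeasure_haar[OF sA] emeasure_haar[OF A] pshiftn_vimage[OF assms]
    by (rule emeasure_lebesgue_affine)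
  also have "\<bar>real p powr k\<bar> ^ DIM(real ^ 'n) = real p powr (real CARD('n) * k)"
    using assms by (simp add: powr_realpow[symmetric] powr_powr mult.commute)
  finally show "emeasure (distr (haar p) (haar p) (pshiftn k)) A 
    = emeasure (density (haar p) (\<lambda>_. ennreal (real p powr (real CARD('n) * k)))) A"
    using A by (simp add: emeasure_distr measurable_pshiftn[OF assms] emeasure_density nn_integral_cmult)
qed simp

lemma nn_integral_pshiftn:
  fixes h :: "padic ^ 'n \<Rightarrow> ennreal"
  assumes "0 < p" and [measurable]: "h \<in> borel_measurable (haar p)"
  shows "(\<integral>\<^sup>+y. h (pshiftn k y) \<partial>haar p) = ennreal (real p powr (real CARD('n) * k)) * (\<integral>\<^sup>+y. h y \<partial>haar p)"
proof -
  have "(\<integral>\<^sup>+y. h (pshiftn k y) \<partial>haar p) = (\<integral>\<^sup>+y. h y \<partial>distr (haar p) (haar p) (pshiftn k))"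
    by (rule nn_integral_distr[symmetric]) (simp_all add: measurable_pshiftn assms)
  also have "\<dots> = ennreal (real p powr (real CARD('n) * k)) * (\<integral>\<^sup>+y. h y \<partial>haar p)"
    by (simp add: distr_pshiftn[OF assms(1)] nn_integral_density nn_integral_cmult)
  finally show ?thesis .
qed

section \<open>Nonnegative integrals and elementary inequalities\<close>

lemma set_nn_integral_eq_LINT:
  fixes g :: "'a \<Rightarrow> real"
  assumes "set_integrable M A g" "\<And>x. 0 \<le> g x"
  shows "(\<integral>\<^sup>+x\<in>A. ennreal (g x) \<partial>M) = ennreal (LINT x:A|M. g x)"
proof -
  have "(\<integral>\<^sup>+x\<in>A. ennreal (g x) \<partial>M) = (\<integral>\<^sup>+x. ennreal (indicator A x *\<^sub>R g x) \<partial>M)"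
    by (intro nn_integral_cong) (auto split: split_indicator)
  also have "\<dots> = ennreal (\<integral>x. indicator A x *\<^sub>R g x \<partial>M)"
    using assms by (intro nn_integral_eq_integral) (auto simp: set_integrable_def)
  finally show ?thesis by (simp add: set_lebesgue_integral_def)
qed

lemma set_integrable_nn_bound:
  fixes g :: "'a \<Rightarrow> real"
  assumes [measurable]: "g \<in> borel_measurable M" "A \<in> sets M" 
    and g: "\<And>x. 0 \<le> g x" and le: "(\<integral>\<^sup>+x\<in>A. ennreal (g x) \<partial>M) \<le> ennreal c" and "0 \<le> c"
  shows "set_integrable M A g" "(LINT x:A|M. g x) \<le> c"
proof -
  have "(\<integral>\<^sup>+x. ennreal (norm (indicator A x *\<^sub>R g x)) \<partial>M) = (\<integral>\<^sup>+x\<in>A. ennreal (g x) \<partial>M)"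
    using g by (intro nn_integral_cong) (auto split: split_indicator)
  also have "\<dots> < \<infinity>" using le by (rule order.strict_trans1) simp
  finally show i: "set_integrable M A g" unfolding set_integrable_def
    by (intro integrableI_bounded) auto
  show "(LINT x:A|M. g x) \<le> c"
    using le \<open>0 \<le> c\<close> set_nn_integral_eq_LINT[OF i g] by simp
qed

text \<open>A crude form of Young's inequality: both bases are raised to their maximum, where the
  exponents add up to 1. Sharp constants are irrelevant here.\<close>

lemma powr_mult_powr_le_add:
  fixes a b s :: real
  assumes "0 \<le> a" "0 \<le> b" "0 \<le> s" "s \<le> 1"
  shows "a powr s * b powr (1 - s) \<le> a + b"
proof -
  have "a powr s * b powr (1 - s) \<le> max a b powr s * max a b powr (1 - s)"
    using assms by (intro mult_mono powr_mono2) auto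
  also have "\<dots> = max a b" using assms by (simp add: powr_add[symmetric])
  finally show ?thesis using assms by linarith
qed

text \<open>Every base is at most the right-hand side \<open>S\<close>. The summand 1 makes
  \<open>S\<close> at least 1, so that a total exponent below 1 is as good as one equal to 1. The
  two families will be the oscillations and the functions \<open>f i\<close>.\<close>

lemma prod_powr_le_1_plus_sum:
  fixes G H \<theta> \<eta> :: "'i \<Rightarrow> real"
  assumes "finite I" "finite J" "\<And>i. i \<in> I \<Longrightarrow> 0 \<le> G i" "\<And>i. i \<in> I \<Longrightarrow> 0 \<le> \<theta> i" 
    "\<And>i. i \<in> J \<Longrightarrow> 0 \<le> H i" "\<And>i. i \<in> J \<Longrightarrow> 0 \<le> \<eta> i" "sum \<theta> I + sum \<eta> J \<le> 1"
  shows "(\<Prod>i\<in>I. G i powr \<theta> i) * (\<Prod>i\<in>J. H i powr \<eta> i) \<le> 1 + sum G I + sum H J"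
proof -
  define S where "S = 1 + sum G I + sum H J"
  have nn: "0 \<le> sum G I" "0 \<le> sum H J" using assms by (auto intro: sum_nonneg)
  then have S: "1 \<le> S" by (simp add: S_def)
  have "(\<Prod>i\<in>I. G i powr \<theta> i) \<le> (\<Prod>i\<in>I. S powr \<theta> i)"
  proof (intro prod_mono conjI powr_mono2)
    fix i assume i: "i \<in> I"
    then have "G i \<le> sum G I" using assms by (intro member_le_sum) auto
    then show "G i \<le> S" using nn by (simp add: S_def)
  qed (use assms in auto)
  moreover have "(\<Prod>i\<in>J. H i powr \<eta> i) \<le> (\<Prod>i\<in>J. S powr \<eta> i)"
  proof (intro prod_mono conjI powr_mono2)
    fix i assume i: "i \<in> J"
    then have "H i \<le> sum H J" using assms by (intro member_le_sum) auto
    then show "H i \<le> S" using nn by (simp add: S_def)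
  qed (use assms in auto)
  ultimately have "(\<Prod>i\<in>I. G i powr \<theta> i) * (\<Prod>i\<in>J. H i powr \<eta> i) \<le> (\<Prod>i\<in>I. S powr \<theta> i) * (\<Prod>i\<in>J. S powr \<eta> i)"
    by (intro mult_mono prod_nonneg) auto
  also have "\<dots> = S powr (sum \<theta> I + sum \<eta> J)" using S by (simp add: powr_sum powr_add)
  also have "\<dots> \<le> S powr 1" using S assms by (intro powr_mono) auto
  finally show ?thesis using S by (simp add: S_def)
qed

lemma powr_add_le:
  fixes a b r :: real
  assumes "0 \<le> a" "0 \<le> b" "0 \<le> r"
  shows "(a + b) powr r \<le> 2 powr r * (a powr r + b powr r)"
proof -
  have "(a + b) powr r \<le> (2 * max a b) powr r" using assms by (intro powr_mono2) auto
  also have "\<dots> = 2 powr r * max a b powr r" using assms by (simp add: powr_mult)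
  also have "max a b powr r \<le> a powr r + b powr r" by (auto simp: max_def)
  finally show ?thesis by simp
qed

section \<open>Muckenhoupt weights on centred balls\<close>

locale padic_weight =
  fixes p :: nat and \<zeta> :: real and w :: "padic ^ 'n \<Rightarrow> real"
  assumes p_gt1: "1 < p" and zeta_ge1: "1 \<le> \<zeta>" and w_A: "A_class p \<zeta> w"
begin

abbreviation M :: "(padic ^ 'n) measure" where "M \<equiv> haar p"
abbreviation B :: "int \<Rightarrow> (padic ^ 'n) set" where "B \<equiv> Bg p"
definition V :: "int \<Rightarrow> real" where "V k = real p powr (real CARD('n) * k)"
definition W :: "int \<Rightarrow> real" where "W k = wmeas p w (B k)"

lemma B_sets [measurable]: "B k \<in> sets M"
  by (rule Bg_sets[OF p_gt1])

lemma w_meas [measurable]: "w \<in> borel_measurable M" 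
  and w_nonneg: "0 \<le> w x" 
  and w_AE_pos: "AE x in M. 0 < w x"
  and w_int: "set_integrable M (B k) w"
  using w_A is_pball_Bg[OF p_gt1] by (auto simp: A_class_def is_weight_def)

lemma V_pos: "0 < V k"
  using p_gt1 by (simp add: V_def)

lemma V_div: "V k / V j = real p powr (real CARD('n) * (k - j))"
  by (simp add: V_def powr_diff[symmetric] algebra_simps)

lemma emeasure_B: "emeasure M (B k) = ennreal (V k)"
  using emeasure_Bg[OF p_gt1] by (simp add: V_def)

lemma measure_B: "measure M (B k) = V k"
  using emeasure_B V_pos[of k] by (simp add: measure_def)

lemma nn_integral_w: "(\<integral>\<^sup>+x\<in>B k. ennreal (w x) \<partial>M) = ennreal (W k)"
  using set_nn_integral_eq_LINT[OF w_int w_nonneg] by (simp add: W_def wmeas_def)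

lemma W_pos: "0 < W k"
proof (rule ccontr)
  assume "\<not> 0 < W k"
  then have "(\<integral>\<^sup>+x\<in>B k. ennreal (w x) \<partial>M) = 0" using nn_integral_w[of k] by (simp add: ennreal_neg)
  then have "AE x in M. ennreal (w x) * indicator (B k) x = 0"
    by (subst (asm) nn_integral_0_iff_AE) auto
  with w_AE_pos have "AE x in M. x \<notin> B k" 
    by eventually_elim (auto split: split_indicator_asm simp: ennreal_eq_0_iff)
  then have "emeasure M (B k) = 0" by (subst (asm) AE_iff_measurable[OF B_sets[of k]]) auto
  then show False using emeasure_B[of k] V_pos[of k] by simp
qed

lemma nn_integral_const_B: "0 \<le> c \<Longrightarrow> (\<integral>\<^sup>+x\<in>B k. ennreal c \<partial>M) = ennreal (c * V k)"
  using V_pos[of k] by (simp add: nn_integral_cmult_indicator emeasure_B ennreal_mult)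

text \<open>The weight is averaged out against \<open>w\<^sup>-\<^sup>1\<^sup>/\<^sup>(\<^sup>\<zeta>\<^sup>-\<^sup>1\<^sup>)\<close> by Young's inequality, with the scale
  \<open>V k / W k\<close>; only centred balls occur in the sequel.\<close>

lemma A_class_average:
  obtains K where "1 \<le> K" 
    "\<And>k g. g \<in> borel_measurable M \<Longrightarrow> (\<And>x. 0 \<le> g x) \<Longrightarrow> (\<integral>\<^sup>+x\<in>B k. ennreal (g x * w x) \<partial>M) \<le> ennreal (W k)
      \<Longrightarrow> (\<integral>\<^sup>+x\<in>B k. ennreal (g x powr (1 / \<zeta>)) \<partial>M) \<le> ennreal (K * V k)"
proof (cases "\<zeta> = 1")
  case True
  then obtain C where C: "\<And>k. W k / V k \<le> C * ess_inf_on M (B k) w"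
    using w_A is_pball_Bg[OF p_gt1] measure_B unfolding A_class_def W_def wmeas_def by metis
  \<comment> \<open>The factor 2 pays for replacing the essential infimum \<open>e\<close> by an
    admissible lower bound above \<open>e / 2\<close>, which avoids discussing whether the supremum
    is attained.\<close>
  define K where "K = 2 * (\<bar>C\<bar> + 1)"
  show ?thesis
  proof
    show "1 \<le> K" by (simp add: K_def)
    fix k and g :: "padic ^ 'n \<Rightarrow> real"
    assume [measurable]: "g \<in> borel_measurable M" and g: "\<And>x. 0 \<le> g x" 
      and gw: "(\<integral>\<^sup>+x\<in>B k. ennreal (g x * w x) \<partial>M) \<le> ennreal (W k)"
    define S where "S = {c. AE x in M. x \<in> B k \<longrightarrow> c \<le> w x}"
    define e where "e = Sup S"
    have S0: "0 \<in> S" using w_nonneg by (auto simp: S_def)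
    \<comment> \<open>\<open>Sup\<close> carries information only for a bounded set; integrating a
      lower bound of the weight over the ball bounds it by the average.\<close>
    have bdd: "bdd_above S"
    proof (rule bdd_aboveI)
      fix c assume "c \<in> S"
      then have ae: "AE x in M. x \<in> B k \<longrightarrow> c \<le> w x" by (simp add: S_def)
      show "c \<le> W k / V k"
      proof (cases "0 \<le> c")
        case True
        have "(\<integral>\<^sup>+x\<in>B k. ennreal c \<partial>M) \<le> (\<integral>\<^sup>+x\<in>B k. ennreal (w x) \<partial>M)"
          using ae by (intro nn_integral_mono_AE) (auto elim!: eventually_mono split: split_indicator intro: ennreal_leI)
        then have "c * V k \<le> W k" using True W_pos[of k] by (simp add: nn_integral_const_B nn_integral_w)
        then show ?thesis using V_pos[of k] by (simp add: field_simps)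
      next
        case False then show ?thesis using W_pos[of k] V_pos[of k] by (smt (verit) divide_pos_pos)
      qed
    qed
    have e0: "0 \<le> e" using S0 bdd by (auto simp: e_def intro: cSup_upper)
    have "W k / V k \<le> C * e" using C[of k] by (simp add: ess_inf_on_def e_def S_def)
    also have "\<dots> \<le> (\<bar>C\<bar> + 1) * e" using e0 by (intro mult_right_mono) auto
    finally have le: "W k / V k \<le> K * (e / 2)" by (simp add: K_def field_simps)
    \<comment> \<open>The average of the weight is positive, which forces \<open>e\<close> to be
      positive and so \<open>e / 2 < e\<close>.\<close>
    moreover have "0 < W k / V k" using W_pos[of k] V_pos[of k] by simp
    ultimately have "0 < K * (e / 2)" by linarith
    then have "0 < e" using e0 by (auto simp: zero_less_mult_iff)
    then have "e / 2 < Sup S" by (simp add: e_def[symmetric])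
    then obtain c where c: "c \<in> S" "e / 2 < c" using less_cSupD S0 by (metis empty_iff)
    have "W k / V k \<le> K * c" using le c \<open>1 \<le> K\<close> by (smt (verit) mult_left_mono)
    then have "AE x in M. x \<in> B k \<longrightarrow> W k / V k \<le> K * w x"
      using c(1) \<open>1 \<le> K\<close> unfolding S_def
      by (auto elim!: eventually_mono intro: order_trans mult_left_mono)
    then have "(\<integral>\<^sup>+x\<in>B k. ennreal (g x powr (1 / \<zeta>)) \<partial>M) 
      \<le> (\<integral>\<^sup>+x. ennreal (K * V k / W k) * (ennreal (g x * w x) * indicator (B k) x) \<partial>M)"
    proof (intro nn_integral_mono_AE, eventually_elim)
      fix x assume x: "x \<in> B k \<longrightarrow> W k / V k \<le> K * w x"
      show "ennreal (g x powr (1 / \<zeta>)) * indicator (B k) x \<le> ennreal (K * V k / W k) * (ennreal (g x * w x) * indicator (B k) x)"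
      proof (cases "x \<in> B k")
        case True
        then have "1 \<le> K * V k / W k * w x" using x W_pos[of k] V_pos[of k] by (simp add: field_simps)
        then have "g x * 1 \<le> g x * (K * V k / W k * w x)" using g by (intro mult_left_mono) auto
        then have "g x powr (1 / \<zeta>) \<le> K * V k / W k * (g x * w x)"
          using \<open>\<zeta> = 1\<close> g by (simp add: mult_ac)
        then show ?thesis using True g w_nonneg \<open>1 \<le> K\<close> V_pos[of k] W_pos[of k]
          by (simp add: ennreal_mult[symmetric] ennreal_leI)
      qed simp
    qed
    also have "\<dots> = ennreal (K * V k / W k) * (\<integral>\<^sup>+x\<in>B k. ennreal (g x * w x) \<partial>M)"
      by (intro nn_integral_cmult) auto
    also have "\<dots> \<le> ennreal (K * V k / W k) * ennreal (W k)" by (intro mult_left_mono gw) auto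
    also have "\<dots> = ennreal (K * V k)" 
      using \<open>1 \<le> K\<close> V_pos[of k] W_pos[of k] by (simp add: ennreal_mult[symmetric])
    finally show "(\<integral>\<^sup>+x\<in>B k. ennreal (g x powr (1 / \<zeta>)) \<partial>M) \<le> ennreal (K * V k)" .
  qed
next
  case False
  then have z: "1 < \<zeta>" using zeta_ge1 by simp
  define \<sigma> where "\<sigma> k = (LINT x : B k | M. w x powr (- 1 / (\<zeta> - 1)))" for k
  obtain C where C: "\<And>k. set_integrable M (B k) (\<lambda>x. w x powr (- 1 / (\<zeta> - 1)))"
    "\<And>k. (W k / V k) * (\<sigma> k / V k) powr (\<zeta> - 1) \<le> C"
    using w_A is_pball_Bg[OF p_gt1] measure_B False unfolding A_class_def W_def wmeas_def \<sigma>_def by metis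
  define K where "K = 1 + \<bar>C\<bar> powr (1 / (\<zeta> - 1))"
  have s_nn: "(\<integral>\<^sup>+x\<in>B k. ennreal (w x powr (- 1 / (\<zeta> - 1))) \<partial>M) = ennreal (\<sigma> k)" for k
    using set_nn_integral_eq_LINT[OF C(1)] by (simp add: \<sigma>_def)
  have s0: "0 \<le> \<sigma> k" for k unfolding \<sigma>_def set_lebesgue_integral_def by (intro integral_nonneg_AE) auto
  show ?thesis
  proof
    show "1 \<le> K" by (simp add: K_def)
    fix k and g :: "padic ^ 'n \<Rightarrow> real"
    assume [measurable]: "g \<in> borel_measurable M" and g: "\<And>x. 0 \<le> g x" 
      and gw: "(\<integral>\<^sup>+x\<in>B k. ennreal (g x * w x) \<partial>M) \<le> ennreal (W k)"
    define t where "t = V k / W k"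
    have t: "0 < t" using W_pos[of k] V_pos[of k] by (simp add: t_def)
    \<comment> \<open>The bases in Young's inequality are \<open>t * g * w\<close> and
      \<open>(t * w)\<close> to the power \<open>-1 / (\<zeta> - 1)\<close>, with exponents
      \<open>1 / \<zeta>\<close> and \<open>1 - 1 / \<zeta>\<close>; the powers of
      \<open>t * w\<close> then cancel exactly.\<close>
    have ineq: "g x powr (1 / \<zeta>) \<le> t * (g x * w x) + t powr (- 1 / (\<zeta> - 1)) * w x powr (- 1 / (\<zeta> - 1))"
      if "0 < w x" for x
    proof -
      have "((t * w x) powr (- 1 / (\<zeta> - 1))) powr (1 - 1 / \<zeta>) = (t * w x) powr (- (1 / \<zeta>))"
      proof -
        have "(- 1 / (\<zeta> - 1)) * (1 - 1 / \<zeta>) = - (1 / \<zeta>)" using z by (simp add: field_simps)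
        then show ?thesis by (simp add: powr_powr)
      qed
      then have "(t * (g x * w x)) powr (1 / \<zeta>) * ((t * w x) powr (- 1 / (\<zeta> - 1))) powr (1 - 1 / \<zeta>) 
          = (g x powr (1 / \<zeta>)) * ((t * w x) powr (1 / \<zeta>) * (t * w x) powr (- (1 / \<zeta>)))"
        using g that t by (simp add: powr_mult)
      also have "\<dots> = g x powr (1 / \<zeta>)" using that t by (simp add: powr_add[symmetric])
      finally have "g x powr (1 / \<zeta>) \<le> t * (g x * w x) + (t * w x) powr (- 1 / (\<zeta> - 1))"
        using powr_mult_powr_le_add[of "t * (g x * w x)" "(t * w x) powr (- 1 / (\<zeta> - 1))" "1 / \<zeta>"] 
          z t g that by simp
      then show ?thesis using t that by (simp add: powr_mult)
    qed
    have "(\<integral>\<^sup>+x\<in>B k. ennreal (g x powr (1 / \<zeta>)) \<partial>M) 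
      \<le> (\<integral>\<^sup>+x. ennreal t * (ennreal (g x * w x) * indicator (B k) x) 
          + ennreal (t powr (- 1 / (\<zeta> - 1))) * (ennreal (w x powr (- 1 / (\<zeta> - 1))) * indicator (B k) x) \<partial>M)"
      using w_AE_pos
    proof (intro nn_integral_mono_AE, eventually_elim)
      fix x assume x: "0 < w x"
      show "ennreal (g x powr (1 / \<zeta>)) * indicator (B k) x \<le> ennreal t * (ennreal (g x * w x) * indicator (B k) x) 
          + ennreal (t powr (- 1 / (\<zeta> - 1))) * (ennreal (w x powr (- 1 / (\<zeta> - 1))) * indicator (B k) x)"
        using ineq[OF x] t g w_nonneg 
        by (auto split: split_indicator simp: ennreal_mult[symmetric] ennreal_plus[symmetric] simp del: ennreal_plus intro!: ennreal_leI)
    qed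
    also have "\<dots> = ennreal t * (\<integral>\<^sup>+x\<in>B k. ennreal (g x * w x) \<partial>M) 
          + ennreal (t powr (- 1 / (\<zeta> - 1))) * (\<integral>\<^sup>+x\<in>B k. ennreal (w x powr (- 1 / (\<zeta> - 1))) \<partial>M)"
      by (subst nn_integral_add) (auto simp: nn_integral_cmult)
    also have "\<dots> \<le> ennreal t * ennreal (W k) + ennreal (t powr (- 1 / (\<zeta> - 1))) * ennreal (\<sigma> k)"
      unfolding s_nn by (intro add_right_mono mult_left_mono gw) auto
    also have "\<dots> = ennreal (t * W k + t powr (- 1 / (\<zeta> - 1)) * \<sigma> k)"
      using t W_pos[of k] s0 by (simp add: ennreal_mult ennreal_plus)
    also have "\<dots> \<le> ennreal (K * V k)"
    proof (rule ennreal_leI)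
      \<comment> \<open>This is the \<open>A_class\<close> inequality to the power
        \<open>1 / (\<zeta> - 1)\<close>, with the average of the weight written as
        \<open>1 / t\<close>.\<close>
      have le: "((1 / t) * (\<sigma> k / V k) powr (\<zeta> - 1)) powr (1 / (\<zeta> - 1)) \<le> \<bar>C\<bar> powr (1 / (\<zeta> - 1))"
        using C(2)[of k] t s0[of k] z W_pos[of k] V_pos[of k]
        by (intro powr_mono2) (auto simp: t_def intro!: mult_nonneg_nonneg divide_nonneg_pos)
      have "((1 / t) * (\<sigma> k / V k) powr (\<zeta> - 1)) powr (1 / (\<zeta> - 1)) 
        = t powr (- 1 / (\<zeta> - 1)) * (\<sigma> k / V k)"
      proof -
        have "(1 / t) powr (1 / (\<zeta> - 1)) = t powr (- 1 / (\<zeta> - 1))" 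
          using t by (simp add: powr_divide powr_minus_divide)
        moreover have "((\<sigma> k / V k) powr (\<zeta> - 1)) powr (1 / (\<zeta> - 1)) = \<sigma> k / V k"
          using z s0[of k] V_pos[of k] by (simp add: powr_powr)
        ultimately show ?thesis using t by (subst powr_mult) auto
      qed
      from le[unfolded this] have "t powr (- 1 / (\<zeta> - 1)) * (\<sigma> k / V k) \<le> \<bar>C\<bar> powr (1 / (\<zeta> - 1))" .
      then have "t powr (- 1 / (\<zeta> - 1)) * \<sigma> k \<le> \<bar>C\<bar> powr (1 / (\<zeta> - 1)) * V k"
        using V_pos[of k] by (simp add: field_simps)
      moreover have "t * W k = V k" using W_pos[of k] by (simp add: t_def)
      ultimately show "t * W k + t powr (- 1 / (\<zeta> - 1)) * \<sigma> k \<le> K * V k" by (simp add: K_def algebra_simps)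
    qed
    finally show "(\<integral>\<^sup>+x\<in>B k. ennreal (g x powr (1 / \<zeta>)) \<partial>M) \<le> ennreal (K * V k)" .
  qed
qed

text \<open>The averaging estimate is tested on a multiple of the indicator of the smaller ball. The
  multiple \<open>R = W k / W j\<close> is the one for which the weighted integral over
  \<open>B k\<close> equals \<open>W k\<close>.\<close>

lemma W_doubling:
  obtains K where "1 \<le> K" 
    "\<And>j k. j \<le> k \<Longrightarrow> W k \<le> K * real p powr (real CARD('n) * \<zeta> * (k - j)) * W j"
proof -
  obtain K where K: "1 \<le> K" 
    "\<And>k g. g \<in> borel_measurable M \<Longrightarrow> (\<And>x. 0 \<le> g x) \<Longrightarrow> (\<integral>\<^sup>+x\<in>B k. ennreal (g x * w x) \<partial>M) \<le> ennreal (W k)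
      \<Longrightarrow> (\<integral>\<^sup>+x\<in>B k. ennreal (g x powr (1 / \<zeta>)) \<partial>M) \<le> ennreal (K * V k)" 
    using A_class_average by blast
  show ?thesis
  proof
    show "1 \<le> K powr \<zeta>" using K zeta_ge1 by (simp add: ge_one_powr_ge_zero)
    fix j k :: int assume jk: "j \<le> k"
    have sub: "B j \<subseteq> B k" using jk by (rule Bg_mono[OF p_gt1])
    define R where "R = W k / W j"
    have R: "0 < R" using W_pos by (simp add: R_def)
    have "(\<integral>\<^sup>+x\<in>B k. ennreal (R * indicator (B j) x * w x) \<partial>M) 
      = (\<integral>\<^sup>+x. ennreal R * (ennreal (w x) * indicator (B j) x) \<partial>M)"
      using sub R w_nonneg by (intro nn_integral_cong) (auto split: split_indicator simp: ennreal_mult)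
    also have "\<dots> = ennreal R * ennreal (W j)" by (subst nn_integral_cmult) (auto simp: nn_integral_w)
    also have "\<dots> = ennreal (W k)" using R W_pos[of j] W_pos[of k] by (simp add: R_def ennreal_mult[symmetric])
    finally have "(\<integral>\<^sup>+x\<in>B k. ennreal ((R * indicator (B j) x) powr (1 / \<zeta>)) \<partial>M) \<le> ennreal (K * V k)"
      using R by (intro K(2)) auto
    moreover have "(\<integral>\<^sup>+x\<in>B k. ennreal ((R * indicator (B j) x) powr (1 / \<zeta>)) \<partial>M) 
      = (\<integral>\<^sup>+x\<in>B j. ennreal (R powr (1 / \<zeta>)) \<partial>M)"
      using sub zeta_ge1 by (intro nn_integral_cong) (auto split: split_indicator)
    ultimately have "R powr (1 / \<zeta>) * V j \<le> K * V k" 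
      using K(1) V_pos[of k] by (simp add: nn_integral_const_B)
    then have "R powr (1 / \<zeta>) \<le> K * (V k / V j)" using V_pos[of j] by (simp add: field_simps)
    then have "(R powr (1 / \<zeta>)) powr \<zeta> \<le> (K * (V k / V j)) powr \<zeta>" 
      using zeta_ge1 by (intro powr_mono2) auto
    then have "R \<le> K powr \<zeta> * (V k / V j) powr \<zeta>" 
      using R zeta_ge1 K(1) V_pos[of k] V_pos[of j] by (subst (asm) powr_mult) (auto simp: powr_powr)
    then have "R \<le> K powr \<zeta> * real p powr (real CARD('n) * \<zeta> * (k - j))"
      by (simp add: V_div powr_powr mult_ac)
    then show "W k \<le> K powr \<zeta> * real p powr (real CARD('n) * \<zeta> * (k - j)) * W j"
      using W_pos[of j] by (simp add: R_def field_simps)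
  qed
qed

text \<open>A reverse Hoelder exponent \<open>r\<close> above \<delta> exists by the definition of
  \<open>r_crit\<close>. Instead of Hoelder's inequality, the weight is cut at a height
  \<open>T\<close>: below it \<open>w\<close> is at most \<open>T\<close>, above it \<open>w\<close>
  is at most \<open>T powr (1 - r) * w powr r\<close>.\<close>

lemma W_reverse_doubling:
  assumes \<delta>: "1 < \<delta>" "\<delta> < r_crit p w" and ne: "RH_indices p w \<noteq> {}"
  obtains K where "1 \<le> K" 
    "\<And>j k. j \<le> k \<Longrightarrow> W j \<le> K * real p powr (- (real CARD('n) * ((\<delta> - 1) / \<delta>) * (k - j))) * W k"
proof -
  obtain r where r: "r \<in> RH_indices p w" "\<delta> < r"
    using less_cSupD[OF ne] \<delta>(2) by (auto simp: r_crit_def)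
  define \<rho> where "\<rho> k = (LINT x : B k | M. w x powr r)" for k
  have "RH_class p r w" using r(1) by (simp add: RH_indices_def)
  then obtain C where C: "\<And>k. set_integrable M (B k) (\<lambda>x. w x powr r)"
    "\<And>k. (\<rho> k / V k) powr (1 / r) \<le> C / V k * W k"
    using is_pball_Bg[OF p_gt1] measure_B unfolding RH_class_def W_def wmeas_def \<rho>_def by metis
  define D where "D = \<bar>C\<bar> powr r"
  have r_nn: "(\<integral>\<^sup>+x\<in>B k. ennreal (w x powr r) \<partial>M) = ennreal (\<rho> k)" for k
    using set_nn_integral_eq_LINT[OF C(1)] by (simp add: \<rho>_def)
  have r0: "0 \<le> \<rho> k" for k unfolding \<rho>_def set_lebesgue_integral_def by (intro integral_nonneg_AE) auto
  have rho: "\<rho> k \<le> D * V k * (W k / V k) powr r" for k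
  proof -
    have "((\<rho> k / V k) powr (1 / r)) powr r \<le> (\<bar>C\<bar> * (W k / V k)) powr r"
    proof (rule powr_mono2)
      have "C / V k * W k \<le> \<bar>C\<bar> * (W k / V k)" using W_pos[of k] V_pos[of k] 
        by (simp add: divide_right_mono mult_right_mono)
      then show "(\<rho> k / V k) powr (1 / r) \<le> \<bar>C\<bar> * (W k / V k)" using C(2)[of k] by linarith
    qed (use r \<delta> in auto)
    moreover have "((\<rho> k / V k) powr (1 / r)) powr r = \<rho> k / V k" using r0[of k] V_pos[of k] r \<delta> by (simp add: powr_powr)
    moreover have "(\<bar>C\<bar> * (W k / V k)) powr r = D * (W k / V k) powr r" 
      using W_pos[of k] V_pos[of k] by (subst powr_mult) (auto simp: D_def)
    ultimately show ?thesis using V_pos[of k] by (simp add: field_simps)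
  qed
  show ?thesis
  proof
    show "1 \<le> 1 + D" by (simp add: D_def)
    fix j k :: int assume jk: "j \<le> k"
    have sub: "B j \<subseteq> B k" using jk by (rule Bg_mono[OF p_gt1])
    define a where "a = W k / V k"
    have a: "0 < a" using W_pos V_pos by (simp add: a_def)
    define u where "u = V k / V j"
    have u: "1 \<le> u" unfolding u_def V_div using jk p_gt1 by (intro ge_one_powr_ge_zero) auto
    \<comment> \<open>This height balances the two parts: up to the constant \<open>D\<close>, the
      part above \<open>T\<close> contributes the same \<open>T * V j\<close> as the part
      below.\<close>
    define T where "T = a * u powr (1 / r)"
    have T: "0 < T" using a u by (simp add: T_def)
    have split: "w x \<le> T + T powr (1 - r) * w x powr r" for x
    proof (cases "w x \<le> T")
      case False
      then have "w x powr 1 = w x powr (1 - r) * w x powr r" using T by (simp add: powr_add[symmetric])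
      also have "\<dots> \<le> T powr (1 - r) * w x powr r" 
        using False T r \<delta> by (intro mult_right_mono powr_mono2') auto
      finally show ?thesis using False T by simp
    qed (auto intro: add_increasing2)
    have "ennreal (W j) = (\<integral>\<^sup>+x\<in>B j. ennreal (w x) \<partial>M)" by (simp add: nn_integral_w)
    also have "\<dots> \<le> (\<integral>\<^sup>+x. ennreal T * indicator (B j) x + ennreal (T powr (1 - r)) * (ennreal (w x powr r) * indicator (B k) x) \<partial>M)"
      using sub split T by (intro nn_integral_mono) (auto split: split_indicator simp: ennreal_mult[symmetric] 
          ennreal_plus[symmetric] simp del: ennreal_plus intro!: ennreal_leI)
    also have "\<dots> = (\<integral>\<^sup>+x\<in>B j. ennreal T \<partial>M) + ennreal (T powr (1 - r)) * (\<integral>\<^sup>+x\<in>B k. ennreal (w x powr r) \<partial>M)"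
      by (subst nn_integral_add) (auto simp: nn_integral_cmult)
    also have "\<dots> = ennreal (T * V j + T powr (1 - r) * \<rho> k)"
      using T V_pos[of j] r0[of k] by (simp add: nn_integral_const_B r_nn ennreal_mult ennreal_plus)
    finally have "W j \<le> T * V j + T powr (1 - r) * \<rho> k"
      using T V_pos[of j] r0[of k] by (simp del: ennreal_plus)
    also have "\<dots> \<le> T * V j + T powr (1 - r) * (D * V k * a powr r)"
      using rho[of k] by (simp add: a_def mult_left_mono)
    also have "T powr (1 - r) * (D * V k * a powr r) = D * (T * V j)"
    proof -
      have "T powr (1 - r) * a powr r = T * (a / T) powr r" using T a by (simp add: powr_diff powr_divide)
      also have "a / T = u powr (- (1 / r))" using a u by (simp add: T_def powr_minus_divide)
      also have "(u powr (- (1 / r))) powr r = 1 / u"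
      proof -
        have e: "- (1 / r) * r = - 1" using r \<delta> by simp
        show ?thesis unfolding powr_powr e using u by (simp add: powr_minus_divide)
      qed
      finally have "T powr (1 - r) * a powr r = T / u" by simp
      moreover have "T powr (1 - r) * (D * V k * a powr r) = D * V k * (T powr (1 - r) * a powr r)" by (simp only: mult_ac)
      ultimately have "T powr (1 - r) * (D * V k * a powr r) = D * V k * (T / u)" by (simp only:)
      then show ?thesis using V_pos[of j] V_pos[of k] by (simp add: u_def)
    qed
    also have "T * V j + D * (T * V j) = (1 + D) * (u powr (1 / r - 1)) * W k"
      using u V_pos[of j] V_pos[of k] by (simp add: T_def a_def powr_diff) (simp add: u_def field_simps)
    \<comment> \<open>Since \<delta> is less than \<open>r\<close> and \<open>u\<close> is at least
      1, the decay obtained from \<open>r\<close> implies the one with \<delta>.\<close>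
    also have "\<dots> \<le> (1 + D) * (u powr (- ((\<delta> - 1) / \<delta>))) * W k"
    proof (intro mult_right_mono mult_left_mono powr_mono)
      have "1 / r < 1 / \<delta>" using r \<delta> by (simp add: frac_less2)
      then show "1 / r - 1 \<le> - ((\<delta> - 1) / \<delta>)" using \<delta> by (simp add: diff_divide_distrib)
    qed (use W_pos[of k] u in \<open>auto simp: D_def\<close>)
    also have "u powr (- ((\<delta> - 1) / \<delta>)) = real p powr (- (real CARD('n) * ((\<delta> - 1) / \<delta>) * (k - j)))"
      by (simp add: u_def V_div powr_powr mult_ac)
    finally show "W j \<le> (1 + D) * real p powr (- (real CARD('n) * ((\<delta> - 1) / \<delta>) * (k - j))) * W k" .
  qed
qed

end

section \<open>Weighted integral bounds\<close>

text \<open>A finite bound on the nonnegative integral already contains integrability, so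
  measurability, sign and size travel together through sums, multiples and products.\<close>

definition int_le :: "'a measure \<Rightarrow> 'a set \<Rightarrow> ('a \<Rightarrow> real) \<Rightarrow> ('a \<Rightarrow> real) \<Rightarrow> real \<Rightarrow> bool" where
  "int_le M A \<omega> g c \<longleftrightarrow> g \<in> borel_measurable M \<and> (\<forall>x. 0 \<le> g x) \<and> 0 \<le> c
     \<and> (\<integral>\<^sup>+x\<in>A. ennreal (g x * \<omega> x) \<partial>M) \<le> ennreal c"

text \<open>It is used on balls with two weights: \<open>w\<close> for the outer integral over
  \<open>x\<close>, and the constant 1 for the inner integral after the change of variables.\<close>

locale weighted_set =
  fixes M :: "'a measure" and A and \<omega> :: "'a \<Rightarrow> real"
  assumes A_sets [measurable]: "A \<in> sets M" and \<omega>_meas [measurable]: "\<omega> \<in> borel_measurable M"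
    and \<omega>_nonneg: "0 \<le> \<omega> x"
begin

lemma int_leD: 
  assumes "int_le M A \<omega> g c"
  shows "g \<in> borel_measurable M" "0 \<le> g x" "0 \<le> c" "(\<integral>\<^sup>+x\<in>A. ennreal (g x * \<omega> x) \<partial>M) \<le> ennreal c"
  using assms by (auto simp: int_le_def)

lemma int_le_add:
  assumes g: "int_le M A \<omega> g c" and h: "int_le M A \<omega> h d"
  shows "int_le M A \<omega> (\<lambda>x. g x + h x) (c + d)"
proof -
  note [measurable] = int_leD(1)[OF g] int_leD(1)[OF h]
  note nn = int_leD(2,3)[OF g] int_leD(2,3)[OF h]
  have "(\<integral>\<^sup>+x\<in>A. ennreal ((g x + h x) * \<omega> x) \<partial>M) 
    = (\<integral>\<^sup>+x. ennreal (g x * \<omega> x) * indicator A x + ennreal (h x * \<omega> x) * indicator A x \<partial>M)"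
    using nn \<omega>_nonneg by (intro nn_integral_cong) (auto split: split_indicator simp: distrib_right ennreal_plus)
  also have "\<dots> = (\<integral>\<^sup>+x\<in>A. ennreal (g x * \<omega> x) \<partial>M) + (\<integral>\<^sup>+x\<in>A. ennreal (h x * \<omega> x) \<partial>M)"
    by (rule nn_integral_add) auto
  also have "\<dots> \<le> ennreal (c + d)"
    using nn by (simp add: ennreal_plus add_mono int_leD(4)[OF g] int_leD(4)[OF h])
  finally show ?thesis using nn unfolding int_le_def by auto
qed

lemma int_le_cmult:
  assumes g: "int_le M A \<omega> g c" and "0 \<le> a"
  shows "int_le M A \<omega> (\<lambda>x. a * g x) (a * c)"
proof -
  note [measurable] = int_leD(1)[OF g]
  note nn = int_leD(2,3)[OF g]
  have "(\<integral>\<^sup>+x\<in>A. ennreal (a * g x * \<omega> x) \<partial>M) = (\<integral>\<^sup>+x. ennreal a * (ennreal (g x * \<omega> x) * indicator A x) \<partial>M)"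
    using nn \<omega>_nonneg \<open>0 \<le> a\<close> by (intro nn_integral_cong) (auto split: split_indicator simp: ennreal_mult mult.assoc)
  also have "\<dots> = ennreal a * (\<integral>\<^sup>+x\<in>A. ennreal (g x * \<omega> x) \<partial>M)"
    by (rule nn_integral_cmult) auto
  also have "\<dots> \<le> ennreal (a * c)"
    using nn \<open>0 \<le> a\<close> by (simp add: ennreal_mult mult_left_mono int_leD(4)[OF g])
  finally show ?thesis using nn \<open>0 \<le> a\<close> unfolding int_le_def by auto
qed

lemma int_le_mono:
  assumes g: "int_le M A \<omega> g c" and [measurable]: "h \<in> borel_measurable M" 
    and h: "\<And>x. 0 \<le> h x" "\<And>x. x \<in> A \<Longrightarrow> h x \<le> g x" and "c \<le> d"
  shows "int_le M A \<omega> h d"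
proof -
  have "(\<integral>\<^sup>+x\<in>A. ennreal (h x * \<omega> x) \<partial>M) \<le> (\<integral>\<^sup>+x\<in>A. ennreal (g x * \<omega> x) \<partial>M)"
    using h \<omega>_nonneg by (intro nn_integral_mono) (auto split: split_indicator intro!: ennreal_leI mult_right_mono)
  also have "\<dots> \<le> ennreal d" using int_leD(4)[OF g] \<open>c \<le> d\<close> by (meson ennreal_leI order_trans)
  finally show ?thesis using h int_leD(3)[OF g] \<open>c \<le> d\<close> by (auto simp: int_le_def)
qed

lemma int_le_sum:
  assumes "finite I" "\<And>i. i \<in> I \<Longrightarrow> int_le M A \<omega> (g i) (c i)"
  shows "int_le M A \<omega> (\<lambda>x. \<Sum>i\<in>I. g i x) (\<Sum>i\<in>I. c i)"
  using assms
proof (induction I rule: finite_induct)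
  case empty then show ?case by (simp add: int_le_def)
next
  case (insert i I) 
  then show ?case using int_le_add[of "g i" "c i"] by simp
qed

text \<open>Replaces the generalised Hoelder inequality: a product of powers whose exponents sum to at
  most \<open>1\<close> is dominated by \<open>1\<close> plus the sum of the bases.\<close>

lemma int_le_prod:
  fixes v \<phi> :: "nat \<Rightarrow> 'a \<Rightarrow> real" and \<rho> \<sigma> :: "nat \<Rightarrow> real"
  assumes fin: "finite I" "finite J" and one: "int_le M A \<omega> (\<lambda>_. 1) c"
    and [measurable]: "\<And>i. i \<in> I \<Longrightarrow> v i \<in> borel_measurable M" "\<And>i. i \<in> J \<Longrightarrow> \<phi> i \<in> borel_measurable M"
    and nn: "\<And>i x. i \<in> I \<Longrightarrow> 0 \<le> v i x" "\<And>i x. i \<in> J \<Longrightarrow> 0 \<le> \<phi> i x"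
    and v: "\<And>i. i \<in> I \<Longrightarrow> int_le M A \<omega> (\<lambda>x. v i x powr \<rho> i) (K * c)"
    and \<phi>: "\<And>i. i \<in> J \<Longrightarrow> int_le M A \<omega> (\<lambda>x. \<phi> i x powr \<sigma> i) (K * c)"
    and pos: "\<And>i. i \<in> I \<Longrightarrow> 0 < \<rho> i" "\<And>i. i \<in> J \<Longrightarrow> 0 < \<sigma> i" "0 < q"
    and exps: "(\<Sum>i\<in>I. q / \<rho> i) + (\<Sum>i\<in>J. q / \<sigma> i) \<le> 1"
  shows "int_le M A \<omega> (\<lambda>x. ((\<Prod>i\<in>I. 1 + v i x) * (\<Prod>i\<in>J. \<phi> i x)) powr q) 
    ((1 + (\<Sum>i\<in>I. 2 powr \<rho> i * (1 + K)) + (\<Sum>i\<in>J. K)) * c)"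
proof (rule int_le_mono)
  show "int_le M A \<omega> (\<lambda>x. 1 + (\<Sum>i\<in>I. 2 powr \<rho> i * (1 + v i x powr \<rho> i)) + (\<Sum>i\<in>J. \<phi> i x powr \<sigma> i))
    (c + (\<Sum>i\<in>I. 2 powr \<rho> i * (c + K * c)) + (\<Sum>i\<in>J. K * c))"
    using fin by (intro int_le_add int_le_sum int_le_cmult one v \<phi>) auto
  show "(\<lambda>x. ((\<Prod>i\<in>I. 1 + v i x) * (\<Prod>i\<in>J. \<phi> i x)) powr q) \<in> borel_measurable M" by measurable
  show "((\<Prod>i\<in>I. 1 + v i x) * (\<Prod>i\<in>J. \<phi> i x)) powr q
    \<le> 1 + (\<Sum>i\<in>I. 2 powr \<rho> i * (1 + v i x powr \<rho> i)) + (\<Sum>i\<in>J. \<phi> i x powr \<sigma> i)" for x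
  proof -
    define G where "G i = (1 + v i x) powr \<rho> i" for i
    define H where "H i = \<phi> i x powr \<sigma> i" for i
    have GH: "0 \<le> G i" "0 \<le> H i" for i by (auto simp: G_def H_def)
    have "((\<Prod>i\<in>I. 1 + v i x) * (\<Prod>i\<in>J. \<phi> i x)) powr q 
      = (\<Prod>i\<in>I. 1 + v i x) powr q * (\<Prod>i\<in>J. \<phi> i x) powr q"
      by (rule powr_mult)
    also have "(\<Prod>i\<in>I. 1 + v i x) powr q = (\<Prod>i\<in>I. (1 + v i x) powr q)"
      by (rule prod_powr_distrib)
    also have "(\<Prod>i\<in>J. \<phi> i x) powr q = (\<Prod>i\<in>J. \<phi> i x powr q)"
      by (rule prod_powr_distrib)
    also have "(\<Prod>i\<in>I. (1 + v i x) powr q) = (\<Prod>i\<in>I. G i powr (q / \<rho> i))"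
      using less_imp_neq[OF pos(1), symmetric] by (intro prod.cong) (auto simp: G_def powr_powr)
    also have "(\<Prod>i\<in>J. \<phi> i x powr q) = (\<Prod>i\<in>J. H i powr (q / \<sigma> i))"
      using less_imp_neq[OF pos(2), symmetric] by (intro prod.cong) (auto simp: H_def powr_powr)
    also have "(\<Prod>i\<in>I. G i powr (q / \<rho> i)) * (\<Prod>i\<in>J. H i powr (q / \<sigma> i)) \<le> 1 + sum G I + sum H J"
      by (rule prod_powr_le_1_plus_sum) (use fin GH pos exps in \<open>auto intro: divide_nonneg_pos less_imp_le\<close>)
    also have "sum G I \<le> (\<Sum>i\<in>I. 2 powr \<rho> i * (1 + v i x powr \<rho> i))"
    proof (rule sum_mono)
      fix i assume "i \<in> I"
      then show "G i \<le> 2 powr \<rho> i * (1 + v i x powr \<rho> i)" 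
        using powr_add_le[of 1 "v i x" "\<rho> i"] nn pos by (auto simp: G_def less_imp_le)
    qed
    finally show ?thesis by (simp add: H_def)
  qed
  show "c + (\<Sum>i\<in>I. 2 powr \<rho> i * (c + K * c)) + (\<Sum>i\<in>J. K * c) \<le> (1 + (\<Sum>i\<in>I. 2 powr \<rho> i * (1 + K)) + (\<Sum>i\<in>J. K)) * c"
  proof -
    have "(\<Sum>i\<in>I. 2 powr \<rho> i * (c + K * c)) = (\<Sum>i\<in>I. 2 powr \<rho> i * (1 + K)) * c"
      unfolding sum_distrib_right by (intro sum.cong) (auto simp: algebra_simps)
    moreover have "(\<Sum>i\<in>J. K * c) = (\<Sum>i\<in>J. K) * c" by (rule sum_distrib_right[symmetric])
    ultimately show ?thesis by (simp add: distrib_right)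
  qed
qed auto

end

section \<open>Oscillation and pairing estimates\<close>

context padic_weight
begin

sublocale w: weighted_set M "B k" w for k
  by unfold_locales (auto simp: w_nonneg)

sublocale u: weighted_set M "B k" "\<lambda>_. 1 :: real" for k
  by unfold_locales auto

lemma int_le_w_one: "int_le M (B k) w (\<lambda>_. 1) (W k)"
  using W_pos[of k] by (simp add: int_le_def nn_integral_w)

lemma int_le_one: "int_le M (B k) (\<lambda>_. 1) (\<lambda>_. 1) (V k)"
  using V_pos[of k] nn_integral_const_B[of 1 k] by (simp add: int_le_def)

text \<open>One constant \<open>C\<close> controls both the oscillation on a ball and the drift of
  the means. The drift is estimated by averaging over the smaller ball the deviation from the mean
  of the larger one; this costs the ratio of the weights of the balls, which is bounded by
  doubling.\<close>

lemma CMO_normalised: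
  assumes b: "b \<in> CMO_space p w r" and r: "1 \<le> r"
  defines "\<beta> \<equiv> \<lambda>k. wmean p w (B k) b"
  obtains C where "0 < C" "\<And>k. int_le M (B k) w (\<lambda>x. (cmod (b x - \<beta> k) / C) powr r) (W k)"
    "\<And>j k. cmod (\<beta> j - \<beta> k) \<le> C * real p powr (real CARD('n) * \<zeta> * \<bar>k - j\<bar>)"
proof -
  have [measurable]: "b \<in> borel_measurable M" 
    and bi: "\<And>k. set_integrable M (B k) (\<lambda>x. cmod (b x) powr r * w x)"
    and bdd: "bdd_above (range (CMO_term p w r b))" using b by (auto simp: CMO_space_def)
  obtain S where S: "\<And>k. CMO_term p w r b k \<le> S" using bdd by (auto simp: bdd_above_def)
  \<comment> \<open>Adding 1 keeps the divisor positive even when \<open>b\<close> has no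
    oscillation.\<close>
  define C0 where "C0 = \<bar>S\<bar> + 1"
  have C0: "0 < C0" by (simp add: C0_def)
  have bw: "int_le M (B k) w (\<lambda>x. cmod (b x) powr r) (LINT x : B k | M. cmod (b x) powr r * w x)" for k
    unfolding int_le_def using set_nn_integral_eq_LINT[OF bi[of k]] w_nonneg
    by (auto simp: set_lebesgue_integral_def intro!: integral_nonneg_AE)
  have osc: "int_le M (B k) w (\<lambda>x. (cmod (b x - \<beta> k) / C0) powr r) (W k)" for k
  proof -
    let ?L = "LINT x : B k | M. cmod (b x - \<beta> k) powr r * w x"
    \<comment> \<open>Integrability of the oscillation has to be derived first: otherwise the
      integral in \<open>CMO_term\<close> could be the default value 0 and its bound would say
      nothing.\<close>
    have "int_le M (B k) w (\<lambda>x. cmod (b x - \<beta> k) powr r)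
      (2 powr r * ((LINT x : B k | M. cmod (b x) powr r * w x) + cmod (\<beta> k) powr r * W k))"
    proof (rule w.int_le_mono)
      show "int_le M (B k) w (\<lambda>x. 2 powr r * (cmod (b x) powr r + cmod (\<beta> k) powr r * 1))
        (2 powr r * ((LINT x : B k | M. cmod (b x) powr r * w x) + cmod (\<beta> k) powr r * W k))"
        by (intro w.int_le_cmult w.int_le_add bw int_le_w_one) auto
      fix x
      have "cmod (b x - \<beta> k) powr r \<le> (cmod (b x) + cmod (\<beta> k)) powr r"
        using r by (intro powr_mono2 norm_triangle_ineq4) auto
      also have "\<dots> \<le> 2 powr r * (cmod (b x) powr r + cmod (\<beta> k) powr r * 1)"
        using powr_add_le[of "cmod (b x)" "cmod (\<beta> k)" r] r by simp
      finally show "cmod (b x - \<beta> k) powr r \<le> 2 powr r * (cmod (b x) powr r + cmod (\<beta> k) powr r * 1)" .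
    qed auto
    then have i: "set_integrable M (B k) (\<lambda>x. cmod (b x - \<beta> k) powr r * w x)"
      unfolding int_le_def using w_nonneg by (intro set_integrable_nn_bound(1)) auto
    have L0: "0 \<le> ?L" using w_nonneg by (auto simp: set_lebesgue_integral_def intro!: integral_nonneg_AE)
    have "(?L / W k) powr (1 / r) \<le> C0" using S[of k] by (simp add: CMO_term_def \<beta>_def W_def C0_def)
    then have "((?L / W k) powr (1 / r)) powr r \<le> C0 powr r" using r by (intro powr_mono2) auto
    then have "?L / W k \<le> C0 powr r" using r L0 W_pos[of k] by (simp add: powr_powr)
    then have L: "?L \<le> C0 powr r * W k" using W_pos[of k] by (simp add: field_simps)
    have "int_le M (B k) w (\<lambda>x. cmod (b x - \<beta> k) powr r) (C0 powr r * W k)"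
      unfolding int_le_def using set_nn_integral_eq_LINT[OF i] w_nonneg L W_pos[of k] 
      by (auto intro: ennreal_leI less_imp_le)
    then have "int_le M (B k) w (\<lambda>x. (1 / C0 powr r) * cmod (b x - \<beta> k) powr r) ((1 / C0 powr r) * (C0 powr r * W k))"
      by (rule w.int_le_cmult) auto
    then show ?thesis using C0 by (simp add: powr_divide)
  qed
  obtain K where K: "1 \<le> K" 
    "\<And>j k. j \<le> k \<Longrightarrow> W k \<le> K * real p powr (real CARD('n) * \<zeta> * (k - j)) * W j" using W_doubling by blast
  have *: "cmod (\<beta> j - \<beta> k) \<le> 2 * C0 * K * real p powr (real CARD('n) * \<zeta> * (k - j))" if jk: "j \<le> k" for j k
  proof -
    have sub: "B j \<subseteq> B k" using jk by (rule Bg_mono[OF p_gt1])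
    have wc: "set_integrable M (B j) (\<lambda>x. complex_of_real (w x) * c)" for c
      using w_int[of j] by (intro set_integrable_mult_left) (simp add: set_integrable_def integrable_of_real indicator_scaleR_eq_if scaleR_conv_of_real flip: of_real_mult)
    \<comment> \<open>Subtracting a constant under the integral requires integrability of
      \<open>w * b\<close>; as \<open>r\<close> is at least 1, it is dominated by
      \<open>w * (1 + |b|^r)\<close>.\<close>
    have wb: "set_integrable M (B j) (\<lambda>x. complex_of_real (w x) * b x)"
    proof (rule set_integrable_bound)
      show "set_integrable M (B j) (\<lambda>x. w x + cmod (b x) powr r * w x)"
        by (intro set_integral_add(1) w_int bi)
      have "cmod (b x) \<le> 1 + cmod (b x) powr r" for x
      proof (cases "cmod (b x) \<le> 1")
        case False
        then have "cmod (b x) powr 1 \<le> cmod (b x) powr r" using r by (intro powr_mono) auto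
        then show ?thesis using False by simp
      qed (auto intro: add_increasing2)
      then have "w x * cmod (b x) \<le> w x * (1 + cmod (b x) powr r)" for x using w_nonneg by (intro mult_left_mono)
      then show "AE x in M. x \<in> B j \<longrightarrow> norm (complex_of_real (w x) * b x) \<le> norm (w x + cmod (b x) powr r * w x)"
        using w_nonneg by (intro AE_I2) (simp add: norm_mult algebra_simps)
    qed (auto simp: set_borel_measurable_def)
    have lin: "(LINT x : B j | M. complex_of_real (w x) * (b x - \<beta> k)) 
        = (LINT x : B j | M. complex_of_real (w x) * b x) - complex_of_real (W j) * \<beta> k"
    proof -
      have "(LINT x : B j | M. complex_of_real (w x) * (b x - \<beta> k)) 
        = (LINT x : B j | M. complex_of_real (w x) * b x) - (LINT x : B j | M. complex_of_real (w x) * \<beta> k)"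
        using set_integral_diff(2)[OF wb wc] by (simp add: algebra_simps)
      also have "(LINT x : B j | M. complex_of_real (w x) * \<beta> k) = (LINT x : B j | M. complex_of_real (w x)) * \<beta> k"
        by simp
      also have "(LINT x : B j | M. complex_of_real (w x)) = complex_of_real (W j)"
        by (simp add: W_def wmeas_def set_integral_complex_of_real)
      finally show ?thesis .
    qed
    have "\<beta> j = (LINT x : B j | M. complex_of_real (w x) * b x) / complex_of_real (W j)" 
      by (simp add: \<beta>_def wmean_def W_def)
    then have eq: "\<beta> j - \<beta> k = (LINT x : B j | M. complex_of_real (w x) * (b x - \<beta> k)) / complex_of_real (W j)"
      unfolding lin using W_pos[of j] by (simp add: diff_divide_distrib)
    have "cmod (LINT x : B j | M. complex_of_real (w x) * (b x - \<beta> k)) 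
      \<le> (LINT x : B j | M. norm (complex_of_real (w x) * (b x - \<beta> k)))"
      using set_integral_diff(1)[OF wb wc[of "\<beta> k"]] by (intro set_integral_norm_bound) (simp add: algebra_simps)
    also have "\<dots> \<le> C0 * (W k + W k)"
    proof (rule set_integrable_nn_bound(2))
      have "int_le M (B k) w (\<lambda>x. cmod (b x - \<beta> k)) (C0 * (W k + W k))"
      proof (rule w.int_le_mono)
        show "int_le M (B k) w (\<lambda>x. C0 * (1 + (cmod (b x - \<beta> k) / C0) powr r)) (C0 * (W k + W k))"
          using C0 by (intro w.int_le_cmult w.int_le_add osc int_le_w_one) auto
        fix x
        define t where "t = cmod (b x - \<beta> k) / C0"
        have "t \<le> 1 + t powr r"
        proof (cases "t \<le> 1")
          case False
          then have "t powr 1 \<le> t powr r" using r by (intro powr_mono) auto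
          then show ?thesis using False by simp
        qed (auto intro: add_increasing2)
        then show "cmod (b x - \<beta> k) \<le> C0 * (1 + (cmod (b x - \<beta> k) / C0) powr r)"
          unfolding t_def[symmetric] using C0 by (simp add: t_def pos_divide_le_eq mult.commute)
      qed auto
      then have "(\<integral>\<^sup>+x\<in>B k. ennreal (cmod (b x - \<beta> k) * w x) \<partial>M) \<le> ennreal (C0 * (W k + W k))"
        by (simp add: int_le_def)
      moreover have "(\<integral>\<^sup>+x\<in>B j. ennreal (norm (complex_of_real (w x) * (b x - \<beta> k))) \<partial>M) 
        \<le> (\<integral>\<^sup>+x\<in>B k. ennreal (cmod (b x - \<beta> k) * w x) \<partial>M)"
        using sub w_nonneg by (intro nn_integral_mono) (auto split: split_indicator simp: norm_mult mult.commute)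
      ultimately show "(\<integral>\<^sup>+x\<in>B j. ennreal (norm (complex_of_real (w x) * (b x - \<beta> k))) \<partial>M) \<le> ennreal (C0 * (W k + W k))"
        by (rule order_trans[rotated])
      show "0 \<le> C0 * (W k + W k)" using C0 W_pos[of k] by simp
    qed auto
    finally have "cmod (\<beta> j - \<beta> k) \<le> C0 * (W k + W k) / W j"
      unfolding eq using W_pos[of j] by (simp add: norm_divide divide_right_mono)
    also have "\<dots> = 2 * C0 * (W k / W j)" by simp
    also have "\<dots> \<le> 2 * C0 * (K * real p powr (real CARD('n) * \<zeta> * (k - j)))"
      using K(2)[OF jk] W_pos[of j] C0 by (intro mult_left_mono) (auto simp: field_simps)
    finally show ?thesis by (simp add: mult_ac)
  qed
  show ?thesis
  proof
    show C: "0 < 2 * C0 * K" using C0 K by simp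
    fix j k
    have "C0 * 1 \<le> C0 * (2 * K)" using C0 K(1) by (intro mult_left_mono) auto
    then have le: "C0 \<le> 2 * C0 * K" by simp
    show "int_le M (B k) w (\<lambda>x. (cmod (b x - \<beta> k) / (2 * C0 * K)) powr r) (W k)"
      by (rule w.int_le_mono[OF osc[of k]]) 
        (use C0 C le r in \<open>auto intro!: powr_mono2 divide_left_mono\<close>)
    show "cmod (\<beta> j - \<beta> k) \<le> 2 * C0 * K * real p powr (real CARD('n) * \<zeta> * \<bar>k - j\<bar>)"
    proof (cases "j \<le> k")
      case True then show ?thesis using *[OF True] by simp
    next
      case False then show ?thesis using *[of k j] by (simp add: norm_minus_commute abs_if)
    qed
  qed
qed

text \<open>Young's inequality takes the place of Hoelder's with exponents \<open>q\<close> and its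
  conjugate; for \<open>q = 1\<close> the essential bound of \<Omega> is used. The additive form
  loses nothing once \<open>h\<close> is normalised.\<close>

lemma Omega_pairing:
  assumes \<Omega>: "Lq_S0 p q \<Omega>" and q: "1 \<le> q"
  obtains C where "0 \<le> C" "\<And>h. h \<in> borel_measurable M \<Longrightarrow> (\<And>y. 0 \<le> h y) 
    \<Longrightarrow> (\<integral>\<^sup>+y\<in>Sg p 0. ennreal (cmod (\<Omega> y) * h y) \<partial>M) \<le> ennreal C + ennreal C * (\<integral>\<^sup>+y\<in>Sg p 0. ennreal (h y powr q) \<partial>M)"
proof (cases "q = 1")
  case True
  then obtain D where D: "AE y in M. y \<in> Sg p 0 \<longrightarrow> cmod (\<Omega> y) \<le> D" using \<Omega> by (auto simp: Lq_S0_def)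
  show ?thesis
  proof
    show "0 \<le> \<bar>D\<bar>" by simp
    fix h :: "padic ^ 'n \<Rightarrow> real" assume [measurable]: "h \<in> borel_measurable M" and h: "\<And>y. 0 \<le> h y"
    note [measurable] = Sg_sets[OF p_gt1]
    have "(\<integral>\<^sup>+y\<in>Sg p 0. ennreal (cmod (\<Omega> y) * h y) \<partial>M) \<le> (\<integral>\<^sup>+y. ennreal \<bar>D\<bar> * (ennreal (h y powr q) * indicator (Sg p 0) y) \<partial>M)"
      using D
    proof (intro nn_integral_mono_AE, eventually_elim)
      fix y assume "y \<in> Sg p 0 \<longrightarrow> cmod (\<Omega> y) \<le> D"
      then show "ennreal (cmod (\<Omega> y) * h y) * indicator (Sg p 0) y \<le> ennreal \<bar>D\<bar> * (ennreal (h y powr q) * indicator (Sg p 0) y)"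
        using h True by (auto split: split_indicator simp: ennreal_mult[symmetric] intro!: ennreal_leI mult_right_mono)
    qed
    also have "\<dots> = ennreal \<bar>D\<bar> * (\<integral>\<^sup>+y\<in>Sg p 0. ennreal (h y powr q) \<partial>M)"
      by (rule nn_integral_cmult) auto
    finally show "(\<integral>\<^sup>+y\<in>Sg p 0. ennreal (cmod (\<Omega> y) * h y) \<partial>M) \<le> ennreal \<bar>D\<bar> + ennreal \<bar>D\<bar> * (\<integral>\<^sup>+y\<in>Sg p 0. ennreal (h y powr q) \<partial>M)"
      by (simp add: add_increasing)
  qed
next
  case False
  then have q: "1 < q" using q by simp
  have [measurable]: "\<Omega> \<in> borel_measurable M" 
    and i: "set_integrable M (Sg p 0) (\<lambda>y. cmod (\<Omega> y) powr (q / (q - 1)))" 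
    using \<Omega> False by (auto simp: Lq_S0_def)
  define D where "D = (LINT y:Sg p 0|M. cmod (\<Omega> y) powr (q / (q - 1)))"
  show ?thesis
  proof
    show "0 \<le> \<bar>D\<bar> + 1" by simp
    fix h :: "padic ^ 'n \<Rightarrow> real" assume [measurable]: "h \<in> borel_measurable M" and h: "\<And>y. 0 \<le> h y"
    note [measurable] = Sg_sets[OF p_gt1]
    have ineq: "cmod (\<Omega> y) * h y \<le> cmod (\<Omega> y) powr (q / (q - 1)) + h y powr q" for y
    proof -
      have "q / (q - 1) * (1 - 1 / q) = 1" using q by (simp add: field_simps)
      then show ?thesis
        using powr_mult_powr_le_add[of "h y powr q" "cmod (\<Omega> y) powr (q / (q - 1))" "1 / q"] q h
        by (simp add: powr_powr mult.commute add.commute)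
    qed
    have "(\<integral>\<^sup>+y\<in>Sg p 0. ennreal (cmod (\<Omega> y) * h y) \<partial>M) 
      \<le> (\<integral>\<^sup>+y. ennreal (cmod (\<Omega> y) powr (q / (q - 1))) * indicator (Sg p 0) y + ennreal (h y powr q) * indicator (Sg p 0) y \<partial>M)"
      using ineq by (intro nn_integral_mono) (auto split: split_indicator simp: ennreal_plus[symmetric] simp del: ennreal_plus intro!: ennreal_leI)
    also have "\<dots> = ennreal D + (\<integral>\<^sup>+y\<in>Sg p 0. ennreal (h y powr q) \<partial>M)"
      using set_nn_integral_eq_LINT[OF i] by (subst nn_integral_add) (auto simp: D_def)
    also have "\<dots> \<le> ennreal (\<bar>D\<bar> + 1) + ennreal (\<bar>D\<bar> + 1) * (\<integral>\<^sup>+y\<in>Sg p 0. ennreal (h y powr q) \<partial>M)"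
    proof (intro add_mono)
      have "1 * (\<integral>\<^sup>+y\<in>Sg p 0. ennreal (h y powr q) \<partial>M) \<le> ennreal (\<bar>D\<bar> + 1) * (\<integral>\<^sup>+y\<in>Sg p 0. ennreal (h y powr q) \<partial>M)"
        by (intro mult_right_mono) auto
      then show "(\<integral>\<^sup>+y\<in>Sg p 0. ennreal (h y powr q) \<partial>M) \<le> ennreal (\<bar>D\<bar> + 1) * (\<integral>\<^sup>+y\<in>Sg p 0. ennreal (h y powr q) \<partial>M)" by simp
      show "ennreal D \<le> ennreal (\<bar>D\<bar> + 1)" by (rule ennreal_leI) simp
    qed
    finally show "(\<integral>\<^sup>+y\<in>Sg p 0. ennreal (cmod (\<Omega> y) * h y) \<partial>M) 
      \<le> ennreal (\<bar>D\<bar> + 1) + ennreal (\<bar>D\<bar> + 1) * (\<integral>\<^sup>+y\<in>Sg p 0. ennreal (h y powr q) \<partial>M)" .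
  qed
qed

text \<open>The substitution \<open>z = p^(-k) y\<close> maps \<open>S_0\<close> to
  \<open>S_k\<close> with Jacobian \<open>1 / V k\<close>. Enlarging the shell to the ball turns the
  right-hand side into an average over \<open>B k\<close>, to which the weight estimates
  apply.\<close>

lemma nn_integral_shell_shift:
  assumes [measurable]: "h \<in> borel_measurable M"
  shows "(\<integral>\<^sup>+y\<in>Sg p 0. h (pshiftn (- k) y) \<partial>M) \<le> ennreal (1 / V k) * (\<integral>\<^sup>+z\<in>B k. h z \<partial>M)"
proof -
  note [measurable] = Sg_sets[OF p_gt1]
  have "(\<integral>\<^sup>+y\<in>Sg p 0. h (pshiftn (- k) y) \<partial>M) 
    = (\<integral>\<^sup>+y. (\<lambda>z. h z * indicator (Sg p k) z) (pshiftn (- k) y) \<partial>M)"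
    by (intro nn_integral_cong) (auto split: split_indicator simp: pshiftn_mem_Sg[OF p_gt1])
  also have "\<dots> = ennreal (real p powr (real CARD('n) * (- k))) * (\<integral>\<^sup>+z. h z * indicator (Sg p k) z \<partial>M)"
    using p_gt1 by (subst nn_integral_pshiftn) auto
  also have "real p powr (real CARD('n) * (- k)) = 1 / V k" by (simp add: V_def powr_minus_divide)
  also have "(\<integral>\<^sup>+z. h z * indicator (Sg p k) z \<partial>M) \<le> (\<integral>\<^sup>+z\<in>B k. h z \<partial>M)"
    using Sg_subset_Bg by (intro nn_integral_mono) (auto split: split_indicator)
  finally show ?thesis by (simp add: mult_left_mono)
qed

end

text \<open>A non-integrable function has integral 0 by convention, so the bound holds in that case
  too.\<close>

lemma norm_integral_le_nn:
  fixes f :: "'a \<Rightarrow> 'b :: {banach, second_countable_topology}"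
  assumes "(\<integral>\<^sup>+x. ennreal (norm (f x)) \<partial>M) \<le> ennreal c" "0 \<le> c"
  shows "norm (\<integral>x. f x \<partial>M) \<le> c"
proof (cases "integrable M f")
  case True
  have "ennreal (norm (\<integral>x. f x \<partial>M)) \<le> ennreal c"
    by (rule order_trans[OF integral_norm_bound_ennreal[OF True] assms(1)])
  then show ?thesis using assms(2) by simp
next
  case False then show ?thesis using assms(2) by (simp add: not_integrable_integral_eq)
qed

section \<open>The commutator on shells\<close>

text \<open>\<open>C i\<close> plays the role of the CMO norm of \<open>b i\<close>, enlarged so that it is positive and absorbs the
  doubling constant of the weight.\<close>

locale commutator = padic_weight p \<zeta> w
  for p \<zeta> and w :: "padic ^ 'n \<Rightarrow> real" +
  fixes m :: nat and q \<delta> :: real and rs qs lam :: "nat \<Rightarrow> real"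
    and \<Omega> :: "padic ^ 'n \<Rightarrow> complex" and \<Phi> :: "padic \<Rightarrow> real" and b :: "nat \<Rightarrow> padic ^ 'n \<Rightarrow> complex"
    and C :: "nat \<Rightarrow> real"
  assumes m_pos: "1 \<le> m" and q_ge: "1 \<le> q"
    and rs_ge: "\<And>i. i \<in> {1..m} \<Longrightarrow> 1 \<le> rs i" and qs_ge: "\<And>i. i \<in> {1..m} \<Longrightarrow> 1 \<le> qs i"
    and lam: "\<And>i. i \<in> {1..m} \<Longrightarrow> - 1 / qs i < lam i \<and> lam i < 0"
    and Phi_nonneg: "\<And>t. 0 \<le> \<Phi> t"
    and Omega_L: "Lq_S0 p q \<Omega>"
    and exps: "((\<Sum>i\<in>{1..m}. 1 / rs i) + (\<Sum>i\<in>{1..m}. 1 / qs i)) * \<zeta> \<le> 1 / q"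
    and delta: "1 < \<delta>" "\<delta> < r_crit p w" and RH_ne: "RH_indices p w \<noteq> {}"
    and b_meas [measurable]: "\<And>i. i \<in> {1..m} \<Longrightarrow> b i \<in> borel_measurable (haar p)"
    and C_pos: "\<And>i. i \<in> {1..m} \<Longrightarrow> 0 < C i"
    and C_osc: "\<And>i k. i \<in> {1..m} \<Longrightarrow>
      int_le (haar p) (Bg p k) w (\<lambda>x. (cmod (b i x - wmean p w (Bg p k) (b i)) / C i) powr rs i) (wmeas p w (Bg p k))"
    and C_mean: "\<And>i j k. i \<in> {1..m} \<Longrightarrow> cmod (wmean p w (Bg p j) (b i) - wmean p w (Bg p k) (b i))
      \<le> C i * real p powr (real CARD('n) * \<zeta> * \<bar>k - j\<bar>)"
begin

section \<open>Normalised oscillations and the arithmetic of the exponents\<close>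

definition \<beta> :: "nat \<Rightarrow> int \<Rightarrow> complex" where "\<beta> i k = wmean p w (B k) (b i)"
definition U :: "nat \<Rightarrow> int \<Rightarrow> padic ^ 'n \<Rightarrow> real" where "U i k x = cmod (b i x - \<beta> i k) / C i"
definition lamS :: real where "lamS = (\<Sum>i\<in>{1..m}. lam i)"
definition d :: real where "d = (\<delta> - 1) / \<delta>"

lemma U_nonneg: "i \<in> {1..m} \<Longrightarrow> 0 \<le> U i k x"
  using C_pos by (simp add: U_def less_imp_le)

lemma U_meas [measurable]: "i \<in> {1..m} \<Longrightarrow> U i k \<in> borel_measurable M"
  unfolding U_def by measurable

lemma U_osc: "i \<in> {1..m} \<Longrightarrow> int_le M (B k) w (\<lambda>x. U i k x powr rs i) (W k)"
  using C_osc by (simp add: U_def \<beta>_def W_def)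

lemma \<Omega>_meas [measurable]: "\<Omega> \<in> borel_measurable M"
  using Omega_L by (simp add: Lq_S0_def)

lemma d_pos: "0 < d" using delta by (simp add: d_def)

lemma sum_inverse_nonneg: "0 \<le> (\<Sum>i\<in>{1..m}. 1 / rs i)" "0 \<le> (\<Sum>i\<in>{1..m}. 1 / qs i)"
  using order_trans[OF zero_le_one rs_ge] order_trans[OF zero_le_one qs_ge] by (auto intro!: sum_nonneg)

lemma lamS_neg: "lamS < 0"
  using sum_strict_mono[of "{1..m}" lam "\<lambda>_. 0"] lam m_pos by (simp add: lamS_def)

text \<open>Each \<open>lam i\<close> exceeds \<open>-1 / qs i\<close>, and the reciprocals of the
  \<open>qs i\<close> sum to at most \<open>1 / q\<close> because \<zeta> is at least 1. Positivity
  of this exponent makes the sum over shells shrinking to the origin converge.\<close>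

lemma lamS_q: "0 < 1 + lamS * q"
proof -
  have "(\<Sum>i\<in>{1..m}. - (1 / qs i)) < lamS"
    unfolding lamS_def using lam m_pos by (intro sum_strict_mono) auto
  then have "- (\<Sum>i\<in>{1..m}. 1 / qs i) < lamS" by (simp add: sum_negf)
  moreover have "(\<Sum>i\<in>{1..m}. 1 / qs i) \<le> 1 / q"
  proof -
    have "(\<Sum>i\<in>{1..m}. 1 / qs i) \<le> ((\<Sum>i\<in>{1..m}. 1 / rs i) + (\<Sum>i\<in>{1..m}. 1 / qs i)) * 1"
      using sum_inverse_nonneg by simp
    also have "\<dots> \<le> ((\<Sum>i\<in>{1..m}. 1 / rs i) + (\<Sum>i\<in>{1..m}. 1 / qs i)) * \<zeta>"
      using sum_inverse_nonneg zeta_ge1 by (intro mult_left_mono) auto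
    finally show ?thesis using exps by linarith
  qed
  ultimately have "- (1 / q) < lamS" by linarith
  then show ?thesis using q_ge by (simp add: field_simps)
qed

text \<open>After unweighting, the available exponents are \<open>rs i / \<zeta>\<close> and
  \<open>qs i / \<zeta>\<close>; this is the condition under which their product can be raised to
  the power \<open>q\<close>.\<close>

lemma exps_scaled: "(\<Sum>i\<in>{1..m}. q / (rs i / \<zeta>)) + (\<Sum>i\<in>{1..m}. q / (qs i / \<zeta>)) \<le> 1"
proof -
  have "(\<Sum>i\<in>{1..m}. q / (rs i / \<zeta>)) + (\<Sum>i\<in>{1..m}. q / (qs i / \<zeta>)) 
    = q * (((\<Sum>i\<in>{1..m}. 1 / rs i) + (\<Sum>i\<in>{1..m}. 1 / qs i)) * \<zeta>)"
    by (simp add: sum_distrib_left sum_distrib_right distrib_left distrib_right)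
  also have "\<dots> \<le> q * (1 / q)" using exps q_ge by (intro mult_left_mono) auto
  finally show ?thesis using q_ge by simp
qed

lemma exps_rs: "(\<Sum>i\<in>{1..m}. q / rs i) \<le> 1"
proof -
  have pos: "0 < rs i" "0 < qs i" if "i \<in> {1..m}" for i using rs_ge[OF that] qs_ge[OF that] by auto
  have "(\<Sum>i\<in>{1..m}. q / rs i) \<le> (\<Sum>i\<in>{1..m}. q / (rs i / \<zeta>))"
    using zeta_ge1 q_ge pos(1) by (intro sum_mono) (auto simp: divide_right_mono less_imp_le)
  also have "\<dots> \<le> (\<Sum>i\<in>{1..m}. q / (rs i / \<zeta>)) + (\<Sum>i\<in>{1..m}. q / (qs i / \<zeta>))"
    using zeta_ge1 q_ge pos by (auto intro!: sum_nonneg simp: less_imp_le)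
  finally show ?thesis using exps_scaled by linarith
qed

text \<open>The integral over \<open>x\<close> carries the weight, so the exponents
  \<open>rs i\<close> apply directly. No \<open>f i\<close> depends on \<open>x\<close>, hence the
  second family is empty and its exponent is a dummy.\<close>

lemma outer_factor:
  obtains K where "0 \<le> K" "\<And>k. int_le M (B k) w (\<lambda>x. (\<Prod>i\<in>{1..m}. 1 + U i k x) powr q) (K * W k)"
proof
  let ?K = "1 + (\<Sum>i\<in>{1..m}. 2 powr rs i * (1 + 1)) + (\<Sum>i\<in>({}::nat set). 1)"
  show "0 \<le> ?K" by (auto intro!: add_nonneg_nonneg sum_nonneg)
  fix k
  have "int_le M (B k) w (\<lambda>x. ((\<Prod>i\<in>{1..m}. 1 + U i k x) * (\<Prod>i\<in>({}::nat set). 1)) powr q) (?K * W k)"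
  proof (rule w.int_le_prod[where \<sigma> = "\<lambda>_. 1" and K = 1])
    show "0 < rs i" if "i \<in> {1..m}" for i using rs_ge[OF that] by simp
  qed (use U_nonneg U_osc int_le_w_one exps_rs q_ge in auto)
  then show "int_le M (B k) w (\<lambda>x. (\<Prod>i\<in>{1..m}. 1 + U i k x) powr q) (?K * W k)" by simp
qed

text \<open>The pairing with \<Omega> leaves an unweighted average over \<open>B k\<close>, while
  \<phi> and \<open>U\<close> are controlled only with the weight. The normalisation by
  \<open>W k\<close> is what makes \<open>K\<close> independent of \<open>k\<close>.\<close>

lemma inner_factor:
  obtains K where "0 \<le> K" "\<And>k \<phi>. (\<And>i. i \<in> {1..m} \<Longrightarrow> \<phi> i \<in> borel_measurable M) \<Longrightarrow> (\<And>i x. i \<in> {1..m} \<Longrightarrow> 0 \<le> \<phi> i x)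
    \<Longrightarrow> (\<And>i. i \<in> {1..m} \<Longrightarrow> int_le M (B k) w (\<lambda>x. \<phi> i x powr qs i) (W k))
    \<Longrightarrow> (\<integral>\<^sup>+y\<in>Sg p 0. ennreal (cmod (\<Omega> y) * ((\<Prod>i\<in>{1..m}. 1 + U i k (pshiftn (- k) y)) 
       * (\<Prod>i\<in>{1..m}. \<phi> i (pshiftn (- k) y)))) \<partial>M) \<le> ennreal K"
proof -
  obtain A where A: "1 \<le> A" 
    "\<And>k g. g \<in> borel_measurable M \<Longrightarrow> (\<And>x. 0 \<le> g x) \<Longrightarrow> (\<integral>\<^sup>+x\<in>B k. ennreal (g x * w x) \<partial>M) \<le> ennreal (W k)
      \<Longrightarrow> (\<integral>\<^sup>+x\<in>B k. ennreal (g x powr (1 / \<zeta>)) \<partial>M) \<le> ennreal (A * V k)" 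
    using A_class_average by blast
  \<comment> \<open>Unweighting a power \<open>s\<close> by the averaging estimate leaves the power
    \<open>s / \<zeta>\<close>.\<close>
  have avg: "int_le M (B k) (\<lambda>_. 1) (\<lambda>x. g x powr (s / \<zeta>)) (A * V k)" 
    if "int_le M (B k) w (\<lambda>x. g x powr s) (W k)" for g s k
  proof -
    have [measurable]: "(\<lambda>x. g x powr s) \<in> borel_measurable M" using that by (simp add: int_le_def)
    have "(\<lambda>x. (g x powr s) powr (1 / \<zeta>)) \<in> borel_measurable M" by measurable
    then have "int_le M (B k) (\<lambda>_. 1) (\<lambda>x. (g x powr s) powr (1 / \<zeta>)) (A * V k)"
      using A(2)[of "\<lambda>x. g x powr s" k] that A(1) V_pos[of k] by (simp add: int_le_def)
    then show ?thesis by (simp add: powr_powr)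
  qed
  obtain D where D: "0 \<le> D" "\<And>h. h \<in> borel_measurable M \<Longrightarrow> (\<And>y. 0 \<le> h y) 
    \<Longrightarrow> (\<integral>\<^sup>+y\<in>Sg p 0. ennreal (cmod (\<Omega> y) * h y) \<partial>M) \<le> ennreal D + ennreal D * (\<integral>\<^sup>+y\<in>Sg p 0. ennreal (h y powr q) \<partial>M)"
    using Omega_pairing[OF Omega_L q_ge] by blast
  define K' where "K' = 1 + (\<Sum>i\<in>{1..m}. 2 powr (rs i / \<zeta>) * (1 + A)) + (\<Sum>i\<in>{1..m}. A)"
  have K': "0 \<le> K'" unfolding K'_def using A(1) by (intro add_nonneg_nonneg sum_nonneg mult_nonneg_nonneg) auto
  show ?thesis
  proof
    show "0 \<le> D + D * K'" using D K' by simp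
    fix k and \<phi> :: "nat \<Rightarrow> padic ^ 'n \<Rightarrow> real"
    assume [measurable]: "\<And>i. i \<in> {1..m} \<Longrightarrow> \<phi> i \<in> borel_measurable M" 
      and \<phi>0: "\<And>i x. i \<in> {1..m} \<Longrightarrow> 0 \<le> \<phi> i x"
      and \<phi>: "\<And>i. i \<in> {1..m} \<Longrightarrow> int_le M (B k) w (\<lambda>x. \<phi> i x powr qs i) (W k)"
    define P where "P z = (\<Prod>i\<in>{1..m}. 1 + U i k z) * (\<Prod>i\<in>{1..m}. \<phi> i z)" for z
    have [measurable]: "P \<in> borel_measurable M" unfolding P_def by measurable
    have P0: "0 \<le> P z" for z unfolding P_def using U_nonneg \<phi>0 
      by (intro mult_nonneg_nonneg prod_nonneg) (auto intro: add_nonneg_nonneg)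
    have "int_le M (B k) (\<lambda>_. 1) (\<lambda>x. P x powr q) (K' * V k)"
      unfolding P_def K'_def
    proof (rule u.int_le_prod[where \<sigma> = "\<lambda>i. qs i / \<zeta>"])
      show "0 < rs i / \<zeta>" "0 < qs i / \<zeta>" if "i \<in> {1..m}" for i 
        using rs_ge[OF that] qs_ge[OF that] zeta_ge1 by auto
    qed (use U_nonneg \<phi>0 int_le_one exps_scaled q_ge avg[OF U_osc] avg[OF \<phi>] in auto)
    then have P: "(\<integral>\<^sup>+z\<in>B k. ennreal (P z powr q) \<partial>M) \<le> ennreal (K' * V k)" by (simp add: int_le_def)
    have [measurable]: "pshiftn (- k) \<in> measurable M M" using p_gt1 by (intro measurable_pshiftn) simp
    have "(\<integral>\<^sup>+y\<in>Sg p 0. ennreal (cmod (\<Omega> y) * P (pshiftn (- k) y)) \<partial>M) 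
      \<le> ennreal D + ennreal D * (\<integral>\<^sup>+y\<in>Sg p 0. ennreal (P (pshiftn (- k) y) powr q) \<partial>M)"
      using P0 by (intro D(2)) auto
    also have "(\<integral>\<^sup>+y\<in>Sg p 0. ennreal (P (pshiftn (- k) y) powr q) \<partial>M) 
      \<le> ennreal (1 / V k) * (\<integral>\<^sup>+z\<in>B k. ennreal (P z powr q) \<partial>M)"
      by (rule nn_integral_shell_shift[of "\<lambda>z. ennreal (P z powr q)"]) simp
    also have "\<dots> \<le> ennreal (1 / V k) * ennreal (K' * V k)" by (intro mult_left_mono P) auto
    also have "\<dots> = ennreal K'" using V_pos[of k] K' by (simp add: ennreal_mult[symmetric])
    also have "ennreal D + ennreal D * ennreal K' = ennreal (D + D * K')" 
      using D K' by (simp add: ennreal_mult ennreal_plus)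
    finally show "(\<integral>\<^sup>+y\<in>Sg p 0. ennreal (cmod (\<Omega> y) * ((\<Prod>i\<in>{1..m}. 1 + U i k (pshiftn (- k) y)) 
       * (\<Prod>i\<in>{1..m}. \<phi> i (pshiftn (- k) y)))) \<partial>M) \<le> ennreal (D + D * K')"
      by (simp add: P_def add_left_mono mult_left_mono)
  qed
qed

section \<open>Pointwise bound for a single dilation\<close>

definition shell_term :: "(nat \<Rightarrow> padic ^ 'n \<Rightarrow> complex) \<Rightarrow> int \<Rightarrow> int \<Rightarrow> padic ^ 'n \<Rightarrow> complex" where
  "shell_term f a \<gamma> x = (LINT y : Sg p 0 | M. \<Omega> y *
          (\<Prod>i\<in>{1..m}. b i x - b i (pshiftn (\<gamma> - a) y)) *
          (\<Prod>i\<in>{1..m}. f i (pshiftn (\<gamma> - a) y)))"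

lemma Hcomm_shell:
  assumes "x \<in> Sg p a"
  shows "Hcomm p m \<Phi> \<Omega> b f x = (\<Sum>\<^sub>\<infinity>\<gamma>::int. complex_of_real (\<Phi> (ppow \<gamma>) / real p powr \<gamma>) * shell_term f a \<gamma> x)"
  unfolding Hcomm_def shell_term_def pdil_Sg[OF p_gt1 assms] ..

text \<open>In \<open>shell_term\<close> the shell index \<open>a\<close> is a parameter not tied to
  \<open>x\<close>. The integral is thus defined by one formula on the whole space, and
  measurability of parameter integrals applies.\<close>

lemma shell_term_meas [measurable]:
  assumes [measurable]: "\<And>i. i \<in> {1..m} \<Longrightarrow> f i \<in> borel_measurable M"
  shows "shell_term f a \<gamma> \<in> borel_measurable M"
proof -
  interpret sigma_finite_measure M by (rule sigma_finite_haar[OF p_gt1])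
  have [measurable]: "pshiftn (\<gamma> - a) \<in> measurable M M" using p_gt1 by (intro measurable_pshiftn) simp
  note [measurable] = Sg_sets[OF p_gt1]
  show ?thesis unfolding shell_term_def set_lebesgue_integral_def by measurable
qed

text \<open>\<open>N i\<close> stands for any positive number exceeding the norm of \<open>f i\<close>; strict positivity allows one
  to divide by it even when the norm vanishes.\<close>

definition admissible :: "(nat \<Rightarrow> real) \<Rightarrow> (nat \<Rightarrow> padic ^ 'n \<Rightarrow> complex) \<Rightarrow> bool" where
  "admissible N f \<longleftrightarrow> (\<forall>i\<in>{1..m}. 0 < N i \<and> f i \<in> borel_measurable M \<and> 
    (\<forall>k. int_le M (B k) w (\<lambda>z. cmod (f i z) powr qs i) (N i powr qs i * W k powr (1 + lam i * qs i))))"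

text \<open>The triangle inequality through the two means gives a sum of three terms. It is relaxed
  to a product so that \<open>x\<close> and \<open>z\<close> separate; the constant 2 matches the
  factor in the assumed series.\<close>

lemma oscillation_split:
  fixes a k :: int
  assumes i: "i \<in> {1..m}"
  shows "cmod (b i x - b i z) \<le> C i * (2 + real p powr (real CARD('n) * \<zeta> * \<bar>a - k\<bar>)) * (1 + U i a x) * (1 + U i k z)"
proof -
  note C = C_pos[OF i] and U = U_nonneg[OF i, of a x] U_nonneg[OF i, of k z]
  define L where "L = real p powr (real CARD('n) * \<zeta> * \<bar>a - k\<bar>)"
  have "b i x - b i z = (b i x - \<beta> i a) + (\<beta> i a - \<beta> i k) - (b i z - \<beta> i k)" by simp
  then have "cmod (b i x - b i z) = cmod ((b i x - \<beta> i a) + (\<beta> i a - \<beta> i k) - (b i z - \<beta> i k))" by (rule arg_cong)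
  also have "\<dots> \<le> cmod (b i x - \<beta> i a) + cmod (\<beta> i a - \<beta> i k) + cmod (b i z - \<beta> i k)"
    by (rule order_trans[OF norm_triangle_ineq4 add_right_mono[OF norm_triangle_ineq]])
  also have "\<dots> \<le> C i * U i a x + C i * L + C i * U i k z"
    using C C_mean[OF i, of a k] by (simp add: U_def L_def \<beta>_def abs_minus_commute)
  also have "\<dots> = C i * (U i a x + L + U i k z)" by (simp add: algebra_simps)
  also have "\<dots> \<le> C i * ((2 + L) * ((1 + U i a x) * (1 + U i k z)))"
  proof (intro mult_left_mono)
    have L: "0 \<le> L" by (simp add: L_def)
    have "U i a x + L + U i k z \<le> (1 + L) * (1 + U i a x + U i k z)" using L U by (simp add: algebra_simps)
    also have "\<dots> \<le> (2 + L) * ((1 + U i a x) * (1 + U i k z))" 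
      using L U by (intro mult_mono) (auto simp: algebra_simps)
    finally show "U i a x + L + U i k z \<le> (2 + L) * ((1 + U i a x) * (1 + U i k z))" .
  qed (use C in auto)
  finally show ?thesis by (simp add: L_def mult.assoc)
qed

lemma shell_term_bound:
  obtains K where "0 \<le> K" "\<And>N f a \<gamma> x. admissible N f \<Longrightarrow>
    cmod (shell_term f a \<gamma> x) \<le> K * (\<Prod>i\<in>{1..m}. N i) * (2 + real p powr (real CARD('n) * \<zeta> * \<bar>\<gamma>\<bar>)) ^ m
       * W (a - \<gamma>) powr lamS * (\<Prod>i\<in>{1..m}. 1 + U i a x)"
proof -
  obtain K where K: "0 \<le> K" "\<And>k \<phi>. (\<And>i. i \<in> {1..m} \<Longrightarrow> \<phi> i \<in> borel_measurable M) \<Longrightarrow> (\<And>i x. i \<in> {1..m} \<Longrightarrow> 0 \<le> \<phi> i x)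
    \<Longrightarrow> (\<And>i. i \<in> {1..m} \<Longrightarrow> int_le M (B k) w (\<lambda>x. \<phi> i x powr qs i) (W k))
    \<Longrightarrow> (\<integral>\<^sup>+y\<in>Sg p 0. ennreal (cmod (\<Omega> y) * ((\<Prod>i\<in>{1..m}. 1 + U i k (pshiftn (- k) y)) 
       * (\<Prod>i\<in>{1..m}. \<phi> i (pshiftn (- k) y)))) \<partial>M) \<le> ennreal K"
    using inner_factor by blast
  show ?thesis
  proof
    show "0 \<le> (\<Prod>i\<in>{1..m}. C i) * K" using K C_pos by (intro mult_nonneg_nonneg prod_nonneg) (auto simp: less_imp_le)
    fix N f and a \<gamma> :: int and x
    assume adm: "admissible N f"
    have N: "0 < N i" if "i \<in> {1..m}" for i using adm that by (auto simp: admissible_def)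
    have f [measurable]: "f i \<in> borel_measurable M" if "i \<in> {1..m}" for i using adm that by (auto simp: admissible_def)
    define k where "k = a - \<gamma>"
    have sh: "\<gamma> - a = - k" by (simp add: k_def)
    have [measurable]: "pshiftn (- k) \<in> measurable M M" using p_gt1 by (intro measurable_pshiftn) simp
    note [measurable] = Sg_sets[OF p_gt1]
    \<comment> \<open>This scaling meets the normalisation demanded by \<open>inner_factor\<close>;
      the factors taken out multiply to the product of the \<open>N i\<close> and
      \<open>W k powr lamS\<close>.\<close>
    define \<phi> where "\<phi> i z = cmod (f i z) / (N i * W k powr lam i)" for i z
    have \<phi>_meas [measurable]: "\<phi> i \<in> borel_measurable M" if "i \<in> {1..m}" for i 
      unfolding \<phi>_def using that by measurable
    have \<phi>0: "0 \<le> \<phi> i z" if "i \<in> {1..m}" for i z using N[OF that] by (simp add: \<phi>_def)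
    have \<phi>: "int_le M (B k) w (\<lambda>z. \<phi> i z powr qs i) (W k)" if i: "i \<in> {1..m}" for i
    proof -
      \<comment> \<open>As the \<open>qs i\<close>-th power of the normalising factor,
        \<open>S\<close> turns the admissible bound into \<open>S * W k\<close>.\<close>
      define S where "S = (N i * W k powr lam i) powr qs i"
      have S: "0 < S" using N[OF i] W_pos[of k] by (simp add: S_def)
      have "int_le M (B k) w (\<lambda>z. (1 / S) * cmod (f i z) powr qs i) ((1 / S) * (N i powr qs i * W k powr (1 + lam i * qs i)))"
        using adm i S by (intro w.int_le_cmult) (auto simp: admissible_def)
      moreover have "N i powr qs i * W k powr (1 + lam i * qs i) = S * W k"
        using N[OF i] W_pos[of k] by (simp add: S_def powr_mult powr_add powr_powr)
      ultimately have "int_le M (B k) w (\<lambda>z. (1 / S) * cmod (f i z) powr qs i) (W k)" using S by simp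
      then show ?thesis by (simp add: \<phi>_def S_def powr_divide)
    qed
    define P where "P z = (\<Prod>i\<in>{1..m}. 1 + U i k z) * (\<Prod>i\<in>{1..m}. \<phi> i z)" for z
    have P0: "0 \<le> P z" for z unfolding P_def using U_nonneg \<phi>0 
      by (intro mult_nonneg_nonneg prod_nonneg) (auto intro: add_nonneg_nonneg)
    have [measurable]: "P \<in> borel_measurable M" unfolding P_def by measurable
    define L where "L = 2 + real p powr (real CARD('n) * \<zeta> * \<bar>\<gamma>\<bar>)"
    have L0: "0 \<le> L" by (simp add: L_def add_nonneg_nonneg)
    define E where "E = (\<Prod>i\<in>{1..m}. C i) * (\<Prod>i\<in>{1..m}. N i) * L ^ m * W k powr lamS * (\<Prod>i\<in>{1..m}. 1 + U i a x)"
    have E0: "0 \<le> E" unfolding E_def using C_pos N L0 U_nonneg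
      by (intro mult_nonneg_nonneg prod_nonneg zero_le_power) (auto intro: add_nonneg_nonneg less_imp_le)
    have Wl: "(\<Prod>i\<in>{1..m}. W k powr lam i) = W k powr lamS"
      using W_pos[of k] by (simp add: lamS_def powr_sum)
    have pt: "cmod (\<Omega> y * (\<Prod>i\<in>{1..m}. b i x - b i z) * (\<Prod>i\<in>{1..m}. f i z)) \<le> E * (cmod (\<Omega> y) * P z)" for y z
    proof -
      have "(\<Prod>i\<in>{1..m}. cmod (b i x - b i z)) \<le> (\<Prod>i\<in>{1..m}. C i * L * (1 + U i a x) * (1 + U i k z))"
        using oscillation_split[of _ x z a k] by (intro prod_mono) (auto simp: L_def k_def)
      also have "\<dots> = (\<Prod>i\<in>{1..m}. C i) * L ^ m * (\<Prod>i\<in>{1..m}. 1 + U i a x) * (\<Prod>i\<in>{1..m}. 1 + U i k z)"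
        by (simp add: prod.distrib)
      finally have 1: "(\<Prod>i\<in>{1..m}. cmod (b i x - b i z)) 
        \<le> (\<Prod>i\<in>{1..m}. C i) * L ^ m * (\<Prod>i\<in>{1..m}. 1 + U i a x) * (\<Prod>i\<in>{1..m}. 1 + U i k z)" .
      have "(\<Prod>i\<in>{1..m}. cmod (f i z)) = (\<Prod>i\<in>{1..m}. N i * W k powr lam i * \<phi> i z)"
      proof (intro prod.cong refl)
        fix i assume "i \<in> {1..m}"
        then show "cmod (f i z) = N i * W k powr lam i * \<phi> i z" using N[of i] W_pos[of k] by (simp add: \<phi>_def)
      qed
      also have "\<dots> = (\<Prod>i\<in>{1..m}. N i) * W k powr lamS * (\<Prod>i\<in>{1..m}. \<phi> i z)"
        by (simp only: prod.distrib Wl)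
      finally have 2: "(\<Prod>i\<in>{1..m}. cmod (f i z)) = (\<Prod>i\<in>{1..m}. N i) * W k powr lamS * (\<Prod>i\<in>{1..m}. \<phi> i z)" .
      have "cmod (\<Omega> y * (\<Prod>i\<in>{1..m}. b i x - b i z) * (\<Prod>i\<in>{1..m}. f i z)) 
        = cmod (\<Omega> y) * (\<Prod>i\<in>{1..m}. cmod (b i x - b i z)) * (\<Prod>i\<in>{1..m}. cmod (f i z))"
        by (simp add: norm_mult prod_norm)
      also have "\<dots> \<le> cmod (\<Omega> y) * ((\<Prod>i\<in>{1..m}. C i) * L ^ m * (\<Prod>i\<in>{1..m}. 1 + U i a x) * (\<Prod>i\<in>{1..m}. 1 + U i k z))
         * (\<Prod>i\<in>{1..m}. cmod (f i z))"
        by (intro mult_right_mono mult_left_mono 1 prod_nonneg) auto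
      also have "\<dots> = E * (cmod (\<Omega> y) * P z)" unfolding 2 E_def P_def by (simp add: mult_ac)
      finally show ?thesis .
    qed
    have "cmod (shell_term f a \<gamma> x) \<le> E * K"
      unfolding shell_term_def set_lebesgue_integral_def sh
    proof (rule norm_integral_le_nn)
      have "(\<integral>\<^sup>+y. ennreal (norm (indicator (Sg p 0) y *\<^sub>R (\<Omega> y * (\<Prod>i\<in>{1..m}. b i x - b i (pshiftn (- k) y)) *
          (\<Prod>i\<in>{1..m}. f i (pshiftn (- k) y))))) \<partial>M)
        \<le> (\<integral>\<^sup>+y. ennreal E * (ennreal (cmod (\<Omega> y) * P (pshiftn (- k) y)) * indicator (Sg p 0) y) \<partial>M)"
        using pt E0 P0 by (intro nn_integral_mono) (auto split: split_indicator simp: ennreal_mult[symmetric] intro!: ennreal_leI)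
      also have "\<dots> = ennreal E * (\<integral>\<^sup>+y\<in>Sg p 0. ennreal (cmod (\<Omega> y) * P (pshiftn (- k) y)) \<partial>M)"
        by (rule nn_integral_cmult) measurable
      also have "\<dots> \<le> ennreal E * ennreal K"
        unfolding P_def by (intro mult_left_mono K(2) \<phi>_meas \<phi>0 \<phi>) auto
      finally show "(\<integral>\<^sup>+y. ennreal (norm (indicator (Sg p 0) y *\<^sub>R (\<Omega> y * (\<Prod>i\<in>{1..m}. b i x - b i (pshiftn (- k) y)) *
          (\<Prod>i\<in>{1..m}. f i (pshiftn (- k) y))))) \<partial>M) \<le> ennreal (E * K)" using E0 K(1) by (simp add: ennreal_mult)
    qed (use E0 K in simp)
    then show "cmod (shell_term f a \<gamma> x) \<le> (\<Prod>i\<in>{1..m}. C i) * K * (\<Prod>i\<in>{1..m}. N i) 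
       * (2 + real p powr (real CARD('n) * \<zeta> * \<bar>\<gamma>\<bar>)) ^ m * W (a - \<gamma>) powr lamS * (\<Prod>i\<in>{1..m}. 1 + U i a x)"
      by (simp add: E_def L_def k_def mult_ac)
  qed
qed


section \<open>Summation over the dilation parameter\<close>

definition E :: "int \<Rightarrow> real" where
  "E \<gamma> = real p powr (- (real_of_int \<gamma> * (real CARD('n) * lamS * (if 0 \<le> \<gamma> then \<zeta> else d))))"

text \<open>\<open>E\<close> measures the change of \<open>W powr lamS\<close> between the two
  balls, by doubling for \<gamma> \<ge> 0 and by reverse doubling for \<gamma> < 0. With it,
  \<open>G\<close> is the general term of both assumed series at once.\<close>

definition G :: "int \<Rightarrow> real" where
  "G \<gamma> = \<Phi> (ppow \<gamma>) / real p powr \<gamma> * (2 + real p powr (real CARD('n) * \<zeta> * \<bar>\<gamma>\<bar>)) ^ m * E \<gamma>"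

lemma E_nonneg: "0 \<le> E \<gamma>" by (simp add: E_def)

lemma G_nonneg: "0 \<le> G \<gamma>"
  unfolding G_def using Phi_nonneg E_nonneg 
  by (intro mult_nonneg_nonneg zero_le_power divide_nonneg_nonneg add_nonneg_nonneg) auto

text \<open>A negative power reverses inequalities, so \<open>W (a - \<gamma>)\<close> must be
  bounded from below by \<open>W a\<close>: \<open>B (a - \<gamma>)\<close> lies inside
  \<open>B a\<close> for \<gamma> \<ge> 0 and contains it otherwise, which decides which doubling
  property is used.\<close>

lemma W_shift:
  obtains K where "0 \<le> K" "\<And>a \<gamma>. W (a - \<gamma>) powr lamS \<le> K * W a powr lamS * E \<gamma>"
proof -
  obtain K1 where K1: "1 \<le> K1" "\<And>j k. j \<le> k \<Longrightarrow> W k \<le> K1 * real p powr (real CARD('n) * \<zeta> * (k - j)) * W j"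
    using W_doubling by blast
  obtain K2 where K2: "1 \<le> K2" "\<And>j k. j \<le> k \<Longrightarrow> W j \<le> K2 * real p powr (- (real CARD('n) * ((\<delta> - 1) / \<delta>) * (k - j))) * W k"
    using W_reverse_doubling[OF delta RH_ne] by blast
  have key: "W (a - \<gamma>) powr lamS \<le> T powr (- lamS) * W a powr lamS * s powr (- lamS)"
    if "W a \<le> T * s * W (a - \<gamma>)" "0 < T" "0 < s" for a \<gamma> T s
  proof -
    have "W a / (T * s) \<le> W (a - \<gamma>)" using that by (simp add: divide_le_eq mult_ac)
    then have "W (a - \<gamma>) powr lamS \<le> (W a / (T * s)) powr lamS"
      using lamS_neg that W_pos[of a] by (intro powr_mono2') auto
    also have "\<dots> = T powr (- lamS) * W a powr lamS * s powr (- lamS)"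
      using that W_pos[of a] by (simp add: powr_divide powr_mult powr_minus field_simps)
    finally show ?thesis .
  qed
  show ?thesis
  proof
    \<comment> \<open>Each sign of \<gamma> uses one of the two constants; their sum serves
      both.\<close>
    show "0 \<le> K1 powr (- lamS) + K2 powr (- lamS)" by simp
    fix a \<gamma> :: int
    have "\<exists>T\<in>{K1, K2}. W (a - \<gamma>) powr lamS \<le> T powr (- lamS) * W a powr lamS * E \<gamma>"
    proof (cases "0 \<le> \<gamma>")
      case True
      have "W a \<le> K1 * real p powr (real CARD('n) * \<zeta> * \<gamma>) * W (a - \<gamma>)"
        using K1(2)[of "a - \<gamma>" a] True by simp
      then have "W (a - \<gamma>) powr lamS \<le> K1 powr (- lamS) * W a powr lamS * (real p powr (real CARD('n) * \<zeta> * \<gamma>)) powr (- lamS)"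
        using K1(1) p_gt1 by (intro key) auto
      also have "(real p powr (real CARD('n) * \<zeta> * \<gamma>)) powr (- lamS) = E \<gamma>"
        using True by (simp add: E_def powr_powr mult_ac)
      finally show ?thesis by blast
    next
      case False
      have "W a \<le> K2 * real p powr (real CARD('n) * d * \<gamma>) * W (a - \<gamma>)"
        using K2(2)[of a "a - \<gamma>"] False by (simp add: d_def)
      then have "W (a - \<gamma>) powr lamS \<le> K2 powr (- lamS) * W a powr lamS * (real p powr (real CARD('n) * d * \<gamma>)) powr (- lamS)"
        using K2(1) p_gt1 by (intro key) auto
      also have "(real p powr (real CARD('n) * d * \<gamma>)) powr (- lamS) = E \<gamma>"
        using False by (simp add: E_def powr_powr mult_ac)
      finally show ?thesis by blast
    qed
    then obtain T where T: "T \<in> {K1, K2}" "W (a - \<gamma>) powr lamS \<le> T powr (- lamS) * (W a powr lamS * E \<gamma>)"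
      by (auto simp: mult.assoc)
    note T(2)
    also have "T powr (- lamS) * (W a powr lamS * E \<gamma>) \<le> (K1 powr (- lamS) + K2 powr (- lamS)) * (W a powr lamS * E \<gamma>)"
      using T(1) E_nonneg by (intro mult_right_mono mult_nonneg_nonneg) auto
    finally show "W (a - \<gamma>) powr lamS \<le> (K1 powr (- lamS) + K2 powr (- lamS)) * W a powr lamS * E \<gamma>"
      by (simp add: mult.assoc)
  qed
qed

text \<open>Summability is recorded separately and for every pair of \<open>a\<close> and
  \<open>x\<close>, because measurability needs the series on the whole space and not only on its
  own shell.\<close>

lemma Hcomm_pointwise:
  assumes G: "G summable_on UNIV"
  obtains K where "0 \<le> K" 
    "\<And>N f a x. admissible N f \<Longrightarrow> 
      (\<lambda>\<gamma>. complex_of_real (\<Phi> (ppow \<gamma>) / real p powr real_of_int \<gamma>) * shell_term f a \<gamma> x) summable_on UNIV"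
    "\<And>N f a x. admissible N f \<Longrightarrow> x \<in> Sg p a \<Longrightarrow> 
      cmod (Hcomm p m \<Phi> \<Omega> b f x) \<le> K * (\<Prod>i\<in>{1..m}. N i) * W a powr lamS * (\<Prod>i\<in>{1..m}. 1 + U i a x)"
proof -
  obtain K1 where K1: "0 \<le> K1" "\<And>N f a \<gamma> x. admissible N f \<Longrightarrow>
    cmod (shell_term f a \<gamma> x) \<le> K1 * (\<Prod>i\<in>{1..m}. N i) * (2 + real p powr (real CARD('n) * \<zeta> * \<bar>\<gamma>\<bar>)) ^ m
       * W (a - \<gamma>) powr lamS * (\<Prod>i\<in>{1..m}. 1 + U i a x)"
    using shell_term_bound by blast
  obtain K2 where K2: "0 \<le> K2" "\<And>a \<gamma>. W (a - \<gamma>) powr lamS \<le> K2 * W a powr lamS * E \<gamma>"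
    using W_shift by blast
  define D where "D N a x = K1 * (\<Prod>i\<in>{1..m}. N i) * (\<Prod>i\<in>{1..m}. 1 + U i a x) * (K2 * W a powr lamS)" for N a x
  define t where "t f a x \<gamma> = complex_of_real (\<Phi> (ppow \<gamma>) / real p powr real_of_int \<gamma>) * shell_term f a \<gamma> x" for f a x and \<gamma> :: int
  have bd: "cmod (t f a x \<gamma>) \<le> D N a x * G \<gamma>" if adm: "admissible N f" for N f a x \<gamma>
  proof -
    let ?c = "\<Phi> (ppow \<gamma>) / real p powr real_of_int \<gamma>"
    let ?L = "(2 + real p powr (real CARD('n) * \<zeta> * \<bar>\<gamma>\<bar>)) ^ m"
    let ?N = "K1 * (\<Prod>i\<in>{1..m}. N i)" and ?U = "\<Prod>i\<in>{1..m}. 1 + U i a x"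
    have nn: "0 \<le> ?c" "0 \<le> ?L" "0 \<le> ?N" "0 \<le> ?U"
      using Phi_nonneg adm K1(1) U_nonneg 
      by (auto simp: admissible_def less_imp_le intro!: mult_nonneg_nonneg prod_nonneg add_nonneg_nonneg zero_le_power)
    have "cmod (t f a x \<gamma>) = ?c * cmod (shell_term f a \<gamma> x)"
      unfolding t_def norm_mult norm_of_real abs_of_nonneg[OF nn(1)] ..
    also have "\<dots> \<le> ?c * (?N * ?L * (K2 * W a powr lamS * E \<gamma>) * ?U)"
      by (rule mult_left_mono[OF order_trans[OF K1(2)[OF adm]]])
        (intro mult_right_mono mult_left_mono K2(2) mult_nonneg_nonneg nn, rule nn)
    also have "\<dots> = D N a x * G \<gamma>" by (simp add: D_def G_def mult_ac)
    finally show ?thesis .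
  qed
  have abs: "(\<lambda>\<gamma>. norm (t f a x \<gamma>)) summable_on UNIV" if adm: "admissible N f" for N f a x
    by (rule summable_on_comparison_test[OF summable_on_cmult_right[OF G, of "D N a x"]]) (use bd[OF adm] in auto)
  show ?thesis
  proof
    show "0 \<le> K1 * K2 * infsum G UNIV" using K1 K2 G_nonneg by (intro mult_nonneg_nonneg infsum_nonneg) auto
    fix N f a x assume adm: "admissible N f"
    show "(\<lambda>\<gamma>. complex_of_real (\<Phi> (ppow \<gamma>) / real p powr real_of_int \<gamma>) * shell_term f a \<gamma> x) summable_on UNIV"
      using abs_summable_summable[OF abs[OF adm]] by (simp add: t_def)
    assume x: "x \<in> Sg p a"
    have "cmod (Hcomm p m \<Phi> \<Omega> b f x) = cmod (infsum (t f a x) UNIV)"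
      unfolding Hcomm_shell[OF x] t_def ..
    also have "\<dots> \<le> (\<Sum>\<^sub>\<infinity>\<gamma>. norm (t f a x \<gamma>))" by (rule norm_infsum_bound[OF abs[OF adm]])
    also have "\<dots> \<le> (\<Sum>\<^sub>\<infinity>\<gamma>. D N a x * G \<gamma>)"
      by (rule infsum_mono[OF abs[OF adm] summable_on_cmult_right[OF G] bd[OF adm]])
    also have "\<dots> = D N a x * infsum G UNIV" by (rule infsum_cmult_right')
    finally show "cmod (Hcomm p m \<Phi> \<Omega> b f x) \<le> K1 * K2 * infsum G UNIV * (\<Prod>i\<in>{1..m}. N i) * W a powr lamS * (\<Prod>i\<in>{1..m}. 1 + U i a x)"
      by (simp add: D_def mult_ac)
  qed
qed

text \<open>On each shell the commutator agrees with a series of measurable functions. There are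
  countably many shells, and on the null remainder completeness makes every set measurable.\<close>

lemma Hcomm_meas:
  assumes f: "\<And>i. i \<in> {1..m} \<Longrightarrow> f i \<in> borel_measurable M"
    and s: "\<And>a x. (\<lambda>\<gamma>. complex_of_real (\<Phi> (ppow \<gamma>) / real p powr real_of_int \<gamma>) * shell_term f a \<gamma> x) summable_on UNIV"
  shows "Hcomm p m \<Phi> \<Omega> b f \<in> borel_measurable M"
proof -
  define t where "t a x \<gamma> = complex_of_real (\<Phi> (ppow \<gamma>) / real p powr real_of_int \<gamma>) * shell_term f a \<gamma> x" for a x and \<gamma> :: int
  \<comment> \<open>Enumerating the integers turns the unordered sum into an ordinary series, a form
    in which measurability is automatic; summability makes the two agree.\<close>
  define h where "h a x = (\<Sum>n. t a x (int_decode n))" for a x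
  have [measurable]: "(\<lambda>x. t a x \<gamma>) \<in> borel_measurable M" for a \<gamma>
    unfolding t_def using shell_term_meas[OF f] by measurable
  have h [measurable]: "h a \<in> borel_measurable M" for a
    unfolding h_def by measurable
  have eq: "Hcomm p m \<Phi> \<Omega> b f x = h a x" if "x \<in> Sg p a" for a x
  proof -
    have "(t a x has_sum infsum (t a x) UNIV) UNIV" using s unfolding t_def by (rule has_sum_infsum)
    then have "((\<lambda>n. t a x (int_decode n)) has_sum infsum (t a x) UNIV) UNIV"
      using has_sum_reindex_bij_betw[OF bij_int_decode, of "t a x"] by simp
    then have "h a x = infsum (t a x) UNIV" unfolding h_def by (intro sums_unique[symmetric] has_sum_imp_sums)
    then show ?thesis unfolding Hcomm_shell[OF that] t_def[symmetric] by (rule sym)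
  qed
  show ?thesis
  proof (rule measurableI)
    fix Y :: "complex set" assume Y: "Y \<in> sets borel"
    let ?H = "Hcomm p m \<Phi> \<Omega> b f"
    have eqY: "?H -` Y = (\<Union>a. h a -` Y \<inter> Sg p a) \<union> (?H -` Y \<inter> - (\<Union>a. Sg p a))"
      using eq by auto
    have "?H -` Y \<inter> - (\<Union>a. Sg p a) \<in> sets M"
      by (intro null_setsD2 null_subset_haar[OF UN_Sg_null[OF p_gt1]]) auto
    moreover have "(\<Union>a. h a -` Y \<inter> Sg p a) \<in> sets M"
    proof (intro sets.countable_UN image_subsetI)
      fix a show "h a -` Y \<inter> Sg p a \<in> sets M"
        using measurable_sets[OF h Y, of a] Sg_sets[OF p_gt1] by auto
    qed
    ultimately have "?H -` Y \<in> sets M" by (subst eqY) (rule sets.Un)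
    then show "?H -` Y \<inter> space M \<in> sets M" by simp
  qed simp
qed

section \<open>From shells to balls\<close>

lemma nn_integral_shells:
  fixes g :: "padic ^ 'n \<Rightarrow> ennreal"
  assumes [measurable]: "g \<in> borel_measurable M"
  shows "(\<integral>\<^sup>+x\<in>B R. g x \<partial>M) \<le> (\<Sum>j. \<integral>\<^sup>+x\<in>Sg p (R - int j). g x \<partial>M)"
proof -
  note [measurable] = Sg_sets[OF p_gt1]
  have "(\<integral>\<^sup>+x\<in>B R. g x \<partial>M) \<le> (\<integral>\<^sup>+x. (\<Sum>j. g x * indicator (Sg p (R - int j)) x) \<partial>M)"
    using AE_UN_Sg[OF p_gt1]
  proof (intro nn_integral_mono_AE, eventually_elim)
    fix x :: "padic ^ 'n" assume "x \<in> (\<Union>a. Sg p a)"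
    then obtain a where a: "x \<in> Sg p a" by blast
    show "g x * indicator (B R) x \<le> (\<Sum>j. g x * indicator (Sg p (R - int j)) x)"
    proof (cases "x \<in> B R")
      case True
      have "a \<le> R"
      proof (rule ccontr)
        assume "\<not> a \<le> R"
        then have "x \<in> Bg p (a - 1)" using True Bg_mono[OF p_gt1, of R "a - 1"] by auto
        then show False using a by (simp add: Sg_eq_Bg_diff[OF p_gt1])
      qed
      then have "g x * indicator (B R) x = (\<Sum>j\<in>{nat (R - a)}. g x * indicator (Sg p (R - int j)) x)"
        using a True by simp
      also have "\<dots> \<le> (\<Sum>j. g x * indicator (Sg p (R - int j)) x)"
        by (rule sum_le_suminf) auto
      finally show ?thesis .
    qed simp
  qed
  also have "\<dots> = (\<Sum>j. \<integral>\<^sup>+x\<in>Sg p (R - int j). g x \<partial>M)"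
    by (rule nn_integral_suminf) measurable
  finally show ?thesis .
qed

text \<open>By reverse doubling the terms decay geometrically with ratio \<open>\<theta>\<close>,
  which is below 1 because \<open>d\<close> and the exponent \<open>1 + lamS * q\<close> are
  positive.\<close>

lemma W_power_sum:
  obtains K where "0 \<le> K" "\<And>R. (\<Sum>j. ennreal (W (R - int j) powr (1 + lamS * q))) \<le> ennreal (K * W R powr (1 + lamS * q))"
proof -
  obtain K2 where K2: "1 \<le> K2" "\<And>j k. j \<le> k \<Longrightarrow> W j \<le> K2 * real p powr (- (real CARD('n) * ((\<delta> - 1) / \<delta>) * (k - j))) * W k"
    using W_reverse_doubling[OF delta RH_ne] by blast
  define e where "e = 1 + lamS * q"
  have e: "0 < e" using lamS_q by (simp add: e_def)
  define \<theta> where "\<theta> = real p powr (- (real CARD('n) * d * e))"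
  have "\<theta> < real p powr 0" unfolding \<theta>_def using p_gt1 d_pos e by (intro powr_less_mono) auto
  then have \<theta>: "0 < \<theta>" "\<theta> < 1" using p_gt1 by (auto simp: \<theta>_def)
  show ?thesis
  proof
    show "0 \<le> K2 powr e / (1 - \<theta>)" using \<theta> by simp
    fix R
    have le: "W (R - int j) powr e \<le> K2 powr e * W R powr e * \<theta> ^ j" for j
    proof -
      have "W (R - int j) powr e \<le> (K2 * real p powr (- (real CARD('n) * d * j)) * W R) powr e"
        using K2(2)[of "R - int j" R] e W_pos[of "R - int j"] by (intro powr_mono2) (auto simp: d_def less_imp_le)
      also have "\<dots> = K2 powr e * (real p powr (- (real CARD('n) * d * j))) powr e * W R powr e"
        by (simp add: powr_mult)
      also have "(real p powr (- (real CARD('n) * d * j))) powr e = \<theta> ^ j"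
        using \<theta>(1) by (simp add: powr_realpow[symmetric]) (simp add: \<theta>_def powr_powr mult_ac)
      finally show ?thesis by (simp add: mult_ac)
    qed
    have "(\<Sum>j. ennreal (W (R - int j) powr e)) \<le> (\<Sum>j. ennreal (K2 powr e * W R powr e * \<theta> ^ j))"
      by (intro suminf_le ennreal_leI le) auto
    also have "\<dots> = ennreal (K2 powr e * W R powr e * (1 / (1 - \<theta>)))"
      using \<theta> by (intro suminf_ennreal_eq sums_mult geometric_sums) auto
    finally show "(\<Sum>j. ennreal (W (R - int j) powr (1 + lamS * q))) \<le> ennreal (K2 powr e / (1 - \<theta>) * W R powr (1 + lamS * q))"
      by (simp add: e_def)
  qed
qed

lemma Hcomm_bound:
  assumes G: "G summable_on UNIV"
  obtains K where "0 \<le> K" 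
    "\<And>N f R. admissible N f \<Longrightarrow> Hcomm p m \<Phi> \<Omega> b f \<in> borel_measurable M 
       \<and> set_integrable M (B R) (\<lambda>x. cmod (Hcomm p m \<Phi> \<Omega> b f x) powr q * w x)
       \<and> B_term p w q lamS (Hcomm p m \<Phi> \<Omega> b f) R \<le> K * (\<Prod>i\<in>{1..m}. N i)"
proof -
  obtain K1 where K1: "0 \<le> K1" 
    "\<And>N f a x. admissible N f \<Longrightarrow> 
      (\<lambda>\<gamma>. complex_of_real (\<Phi> (ppow \<gamma>) / real p powr real_of_int \<gamma>) * shell_term f a \<gamma> x) summable_on UNIV"
    "\<And>N f a x. admissible N f \<Longrightarrow> x \<in> Sg p a \<Longrightarrow> 
      cmod (Hcomm p m \<Phi> \<Omega> b f x) \<le> K1 * (\<Prod>i\<in>{1..m}. N i) * W a powr lamS * (\<Prod>i\<in>{1..m}. 1 + U i a x)"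
    using Hcomm_pointwise[OF G] by blast
  obtain K2 where K2: "0 \<le> K2" "\<And>k. int_le M (B k) w (\<lambda>x. (\<Prod>i\<in>{1..m}. 1 + U i k x) powr q) (K2 * W k)"
    using outer_factor by blast
  obtain K3 where K3: "0 \<le> K3" "\<And>R. (\<Sum>j. ennreal (W (R - int j) powr (1 + lamS * q))) \<le> ennreal (K3 * W R powr (1 + lamS * q))"
    using W_power_sum by blast
  show ?thesis
  proof
    \<comment> \<open>\<open>K1\<close> bounds the function itself, whereas \<open>K2\<close> and
      \<open>K3\<close> bound integrals and sums of its \<open>q\<close>-th power and therefore
      enter through a \<open>q\<close>-th root.\<close>
    show "0 \<le> K1 * (K2 * K3) powr (1 / q)" using K1 by simp
    fix N f R assume adm: "admissible N f"
    let ?H = "Hcomm p m \<Phi> \<Omega> b f"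
    define N' where "N' = (\<Prod>i\<in>{1..m}. N i)"
    have N': "0 \<le> N'" using adm unfolding N'_def by (intro prod_nonneg) (auto simp: admissible_def less_imp_le)
    have [measurable]: "?H \<in> borel_measurable M"
      by (rule Hcomm_meas[OF _ K1(2)[OF adm]]) (use adm in \<open>auto simp: admissible_def\<close>)
    note [measurable] = Sg_sets[OF p_gt1]
    \<comment> \<open>\<open>S\<close> collects what does not depend on the shell; the weight
      \<open>W a\<close> of the ball joins the power \<open>lamS * q\<close> to form
      \<open>1 + lamS * q\<close>.\<close>
    define S where "S = (K1 * N') powr q * K2"
    have S: "0 \<le> S" using K2 by (simp add: S_def)
    have shell: "(\<integral>\<^sup>+x\<in>Sg p a. ennreal (cmod (?H x) powr q * w x) \<partial>M) \<le> ennreal S * ennreal (W a powr (1 + lamS * q))" for a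
    proof -
      define c where "c = (K1 * N' * W a powr lamS) powr q"
      let ?P = "\<lambda>x. \<Prod>i\<in>{1..m}. 1 + U i a x"
      have pw: "cmod (?H x) powr q \<le> c * ?P x powr q" if "x \<in> Sg p a" for x
      proof -
        have "cmod (?H x) powr q \<le> (K1 * N' * W a powr lamS * ?P x) powr q"
          using K1(3)[OF adm that] q_ge by (intro powr_mono2) (auto simp: N'_def)
        then show ?thesis unfolding c_def by (simp only: powr_mult)
      qed
      have "(\<integral>\<^sup>+x\<in>Sg p a. ennreal (cmod (?H x) powr q * w x) \<partial>M) \<le> (\<integral>\<^sup>+x\<in>B a. ennreal (c * ?P x powr q * w x) \<partial>M)"
        using pw Sg_subset_Bg[of p a] w_nonneg by (intro nn_integral_mono) (auto split: split_indicator intro!: ennreal_leI mult_right_mono)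
      also have "\<dots> \<le> ennreal (c * (K2 * W a))"
        by (rule w.int_leD(4)[OF w.int_le_cmult[OF K2(2)]]) (simp add: c_def)
      also have "c * (K2 * W a) = S * W a powr (1 + lamS * q)"
        using W_pos[of a] by (simp add: c_def S_def powr_mult powr_powr powr_add)
      finally show ?thesis using S by (simp add: ennreal_mult)
    qed
    have "(\<integral>\<^sup>+x\<in>B R. ennreal (cmod (?H x) powr q * w x) \<partial>M) 
      \<le> (\<Sum>j. \<integral>\<^sup>+x\<in>Sg p (R - int j). ennreal (cmod (?H x) powr q * w x) \<partial>M)"
      by (rule nn_integral_shells) measurable
    also have "\<dots> \<le> (\<Sum>j. ennreal S * ennreal (W (R - int j) powr (1 + lamS * q)))"
      by (intro suminf_le shell) auto
    also have "\<dots> = ennreal S * (\<Sum>j. ennreal (W (R - int j) powr (1 + lamS * q)))" by simp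
    also have "\<dots> \<le> ennreal S * ennreal (K3 * W R powr (1 + lamS * q))" by (intro mult_left_mono K3) auto
    also have "\<dots> = ennreal (S * (K3 * W R powr (1 + lamS * q)))" using S K3 by (simp add: ennreal_mult)
    finally have le: "(\<integral>\<^sup>+x\<in>B R. ennreal (cmod (?H x) powr q * w x) \<partial>M) \<le> ennreal (S * (K3 * W R powr (1 + lamS * q)))" .
    have nn: "0 \<le> S * (K3 * W R powr (1 + lamS * q))" using S K3 by simp
    note bd = set_integrable_nn_bound[OF _ B_sets _ le nn]
    have i: "set_integrable M (B R) (\<lambda>x. cmod (?H x) powr q * w x)"
      by (rule bd(1)) (auto simp: w_nonneg)
    have L: "(LINT x:B R|M. cmod (?H x) powr q * w x) \<le> S * (K3 * W R powr (1 + lamS * q))"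
      by (rule bd(2)) (auto simp: w_nonneg)
    have L0: "0 \<le> (LINT x:B R|M. cmod (?H x) powr q * w x)"
      using w_nonneg by (auto simp: set_lebesgue_integral_def intro!: integral_nonneg_AE)
    have "B_term p w q lamS ?H R \<le> (W R powr (- 1 - lamS * q) * (S * (K3 * W R powr (1 + lamS * q)))) powr (1 / q)"
      unfolding B_term_def W_def[symmetric] using L L0 q_ge by (intro powr_mono2 mult_left_mono mult_nonneg_nonneg) auto
    also have "W R powr (- 1 - lamS * q) * (S * (K3 * W R powr (1 + lamS * q))) = (K1 * N') powr q * (K2 * K3)"
    proof -
      have "W R powr (- 1 - lamS * q) * W R powr (1 + lamS * q) = 1"
        using W_pos[of R] by (simp add: powr_add[symmetric])
      moreover have "W R powr (- 1 - lamS * q) * (S * (K3 * W R powr (1 + lamS * q))) 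
        = S * K3 * (W R powr (- 1 - lamS * q) * W R powr (1 + lamS * q))"
        by (simp only: mult_ac)
      ultimately show ?thesis by (simp only: S_def mult_1_right mult.assoc)
    qed
    also have "\<dots> powr (1 / q) = K1 * (K2 * K3) powr (1 / q) * N'"
      using q_ge K1(1) N' by (simp add: powr_mult powr_powr mult_ac)
    finally show "?H \<in> borel_measurable M \<and> set_integrable M (B R) (\<lambda>x. cmod (?H x) powr q * w x)
       \<and> B_term p w q lamS ?H R \<le> K1 * (K2 * K3) powr (1 / q) * (\<Prod>i\<in>{1..m}. N i)"
      using i by (auto simp: N'_def)
  qed
qed

section \<open>Passage to the norms\<close>

lemma B_norm_nonneg: "f \<in> B_space p w s \<mu> \<Longrightarrow> 0 \<le> B_norm p w s \<mu> f"
  unfolding B_norm_def B_space_def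
  by (rule cSUP_upper2[of _ _ 0]) (auto simp: B_term_def)

lemma admissible_B_norm:
  assumes f: "\<And>i. i \<in> {1..m} \<Longrightarrow> f i \<in> B_space p w (qs i) (lam i)" and \<epsilon>: "0 < \<epsilon>"
  shows "admissible (\<lambda>i. B_norm p w (qs i) (lam i) (f i) + \<epsilon>) f"
  unfolding admissible_def
proof (intro ballI conjI allI)
  fix i k assume i: "i \<in> {1..m}"
  let ?N = "B_norm p w (qs i) (lam i) (f i) + \<epsilon>"
  let ?L = "LINT x : B k | M. cmod (f i x) powr qs i * w x"
  show N: "0 < ?N" using B_norm_nonneg[OF f[OF i]] \<epsilon> by simp
  show fm: "f i \<in> borel_measurable M" using f[OF i] by (simp add: B_space_def)
  have s: "1 \<le> qs i" by (rule qs_ge[OF i])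
  have int: "set_integrable M (B k) (\<lambda>x. cmod (f i x) powr qs i * w x)" using f[OF i] by (simp add: B_space_def)
  have L0: "0 \<le> ?L" using w_nonneg by (auto simp: set_lebesgue_integral_def intro!: integral_nonneg_AE)
  have "B_term p w (qs i) (lam i) (f i) k \<le> B_norm p w (qs i) (lam i) (f i)"
    unfolding B_norm_def using f[OF i] by (intro cSUP_upper) (auto simp: B_space_def)
  then have "(W k powr (- 1 - lam i * qs i) * ?L) powr (1 / qs i) \<le> ?N"
    using \<epsilon> by (simp add: B_term_def W_def)
  then have "((W k powr (- 1 - lam i * qs i) * ?L) powr (1 / qs i)) powr qs i \<le> ?N powr qs i"
    using s by (intro powr_mono2) auto
  then have "W k powr (- 1 - lam i * qs i) * ?L \<le> ?N powr qs i" using s L0 by (simp add: powr_powr)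
  then have "W k powr (1 + lam i * qs i) * (W k powr (- 1 - lam i * qs i) * ?L) \<le> W k powr (1 + lam i * qs i) * ?N powr qs i"
    by (intro mult_left_mono) auto
  moreover have "W k powr (1 + lam i * qs i) * (W k powr (- 1 - lam i * qs i) * ?L) = ?L"
    using W_pos[of k] by (simp add: powr_add[symmetric] flip: mult.assoc)
  ultimately have "?L \<le> W k powr (1 + lam i * qs i) * ?N powr qs i" by (simp only:)
  then have "?L \<le> ?N powr qs i * W k powr (1 + lam i * qs i)" by (simp only: mult.commute)
  then show "int_le M (B k) w (\<lambda>z. cmod (f i z) powr qs i) (?N powr qs i * W k powr (1 + lam i * qs i))"
    using set_nn_integral_eq_LINT[OF int] w_nonneg fm by (auto simp: int_le_def intro: ennreal_leI)
qed

theorem Hcomm_bounded: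
  assumes G: "G summable_on UNIV"
  shows "\<exists>K. \<forall>f. (\<forall>i\<in>{1..m}. f i \<in> B_space p w (qs i) (lam i)) \<longrightarrow>
     Hcomm p m \<Phi> \<Omega> b f \<in> B_space p w q lamS \<and>
     B_norm p w q lamS (Hcomm p m \<Phi> \<Omega> b f) \<le> K * (\<Prod>i\<in>{1..m}. B_norm p w (qs i) (lam i) (f i))"
proof -
  obtain K where K: "\<And>N f R. admissible N f \<Longrightarrow> Hcomm p m \<Phi> \<Omega> b f \<in> borel_measurable M 
       \<and> set_integrable M (B R) (\<lambda>x. cmod (Hcomm p m \<Phi> \<Omega> b f x) powr q * w x)
       \<and> B_term p w q lamS (Hcomm p m \<Phi> \<Omega> b f) R \<le> K * (\<Prod>i\<in>{1..m}. N i)"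
    by (rule Hcomm_bound[OF G], rule that)
  show ?thesis
  proof (intro exI allI impI)
    fix f :: "nat \<Rightarrow> padic ^ 'n \<Rightarrow> complex"
    assume f: "\<forall>i\<in>{1..m}. f i \<in> B_space p w (qs i) (lam i)"
    let ?H = "Hcomm p m \<Phi> \<Omega> b f" and ?N = "\<lambda>i. B_norm p w (qs i) (lam i) (f i)"
    have adm: "admissible (\<lambda>i. ?N i + \<epsilon>) f" if "0 < \<epsilon>" for \<epsilon> using admissible_B_norm f that by blast
    have bd: "B_term p w q lamS ?H R \<le> K * (\<Prod>i\<in>{1..m}. ?N i)" for R
    \<comment> \<open>The constant \<open>K\<close> does not depend on the slack \<epsilon> added to
      the norms, so \<epsilon> may tend to 0 from the right; this also covers vanishing
      norms.\<close>
    proof (rule tendsto_lowerbound)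
      have "((\<lambda>\<epsilon>. K * (\<Prod>i\<in>{1..m}. ?N i + \<epsilon>)) \<longlongrightarrow> K * (\<Prod>i\<in>{1..m}. ?N i + 0)) (at_right 0)"
        by (intro tendsto_intros)
      then show "((\<lambda>\<epsilon>. K * (\<Prod>i\<in>{1..m}. ?N i + \<epsilon>)) \<longlongrightarrow> K * (\<Prod>i\<in>{1..m}. ?N i)) (at_right 0)" by simp
      show "\<forall>\<^sub>F \<epsilon> in at_right 0. B_term p w q lamS ?H R \<le> K * (\<Prod>i\<in>{1..m}. ?N i + \<epsilon>)"
        using K[OF adm] by (auto simp: eventually_at_right_field intro!: exI[of _ 1])
    qed simp
    have "bdd_above (range (B_term p w q lamS ?H))" by (rule bdd_aboveI[of _ "K * (\<Prod>i\<in>{1..m}. ?N i)"]) (use bd in auto)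
    then have "?H \<in> B_space p w q lamS" using K[OF adm[of 1]] by (auto simp: B_space_def)
    moreover have "B_norm p w q lamS ?H \<le> K * (\<Prod>i\<in>{1..m}. ?N i)"
      unfolding B_norm_def[of p w q lamS ?H] by (rule cSUP_least) (use bd in auto)
    ultimately show "?H \<in> B_space p w q lamS \<and> B_norm p w q lamS ?H \<le> K * (\<Prod>i\<in>{1..m}. ?N i)" by blast
  qed
qed

end

theorem theorem4p2:
  fixes p m :: nat
    and q \<zeta> \<delta> :: real
    and rs qs lam :: "nat \<Rightarrow> real"
    and w :: "padic ^ 'n \<Rightarrow> real"
    and \<Omega> :: "padic ^ 'n \<Rightarrow> complex"
    and \<Phi> :: "padic \<Rightarrow> real"
    and b :: "nat \<Rightarrow> padic ^ 'n \<Rightarrow> complex"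
  assumes p_prime: "prime p"
    and m_pos: "1 \<le> m"
    and q_ge: "1 \<le> q"
    and rs_ge: "\<forall>i\<in>{1..m}. 1 \<le> rs i"
    and qs_ge: "\<forall>i\<in>{1..m}. 1 \<le> qs i"
    and zeta_ge: "1 \<le> \<zeta>"
    and Phi_nonneg: "\<forall>t. 0 \<le> \<Phi> t"
    and Omega_meas: "\<Omega> \<in> borel_measurable (haar p)"
    and Omega_nz: "AE y in haar p. y \<in> Sg p 0 \<longrightarrow> \<Omega> y \<noteq> 0"
    and w_A: "A_class p \<zeta> w"
    and r_ne: "RH_indices p w \<noteq> {}"
    and r_fin: "bdd_above (RH_indices p w)"
    and delta: "1 < \<delta>" "\<delta> < r_crit p w"
    and Omega_L: "Lq_S0 p q \<Omega>"
    and lam: "\<forall>i\<in>{1..m}. - 1 / qs i < lam i \<and> lam i < 0"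
    and b_CMO: "\<forall>i\<in>{1..m}. b i \<in> CMO_space p w (rs i)"
    and exps: "1 / q > ((\<Sum>i\<in>{1..m}. 1 / rs i) + (\<Sum>i\<in>{1..m}. 1 / qs i))
                      * \<zeta> * (r_crit p w / (r_crit p w - 1))"
    and C7_pos: "(\<lambda>\<gamma>::int. \<Phi> (ppow \<gamma>)
                 / real p powr (real_of_int \<gamma> * (1 + real CARD('n) * \<zeta> * (\<Sum>i\<in>{1..m}. lam i)))
                 * (2 + real p powr (real_of_int \<gamma> * \<zeta> * real CARD('n))) ^ m) summable_on {0..}"
    and C7_neg: "(\<lambda>\<gamma>::int. \<Phi> (ppow \<gamma>)
                 / real p powr (real_of_int \<gamma> * (1 + real CARD('n) * (\<Sum>i\<in>{1..m}. lam i) * (\<delta> - 1) / \<delta>))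
                 * (2 + real p powr (- real_of_int \<gamma> * \<zeta> * real CARD('n))) ^ m) summable_on {..<0}"
  shows "\<exists>C. \<forall>f :: nat \<Rightarrow> padic ^ 'n \<Rightarrow> complex.
           (\<forall>i\<in>{1..m}. f i \<in> B_space p w (qs i) (lam i)) \<longrightarrow>
             Hcomm p m \<Phi> \<Omega> b f \<in> B_space p w q (\<Sum>i\<in>{1..m}. lam i) \<and>
             B_norm p w q (\<Sum>i\<in>{1..m}. lam i) (Hcomm p m \<Phi> \<Omega> b f)
               \<le> C * (\<Prod>i\<in>{1..m}. B_norm p w (qs i) (lam i) (f i))"
proof -
  have p: "1 < p" using p_prime by (rule prime_gt_1_nat)
  interpret padic_weight p \<zeta> w
    by unfold_locales (use p zeta_ge w_A in auto)
  let ?S = "(\<Sum>i\<in>{1..m}. 1 / rs i) + (\<Sum>i\<in>{1..m}. 1 / qs i)"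
  have S0: "0 \<le> ?S * \<zeta>"
    using order_trans[OF zero_le_one rs_ge[rule_format]] order_trans[OF zero_le_one qs_ge[rule_format]] zeta_ge
    by (auto intro!: mult_nonneg_nonneg add_nonneg_nonneg sum_nonneg)
  \<comment> \<open>The critical index exceeds \<delta> and hence 1, so the quotient is at least 1
    and the exponent hypothesis yields the inequality required by the locale.\<close>
  have "1 \<le> r_crit p w / (r_crit p w - 1)" using delta by simp
  then have "?S * \<zeta> * 1 \<le> ?S * \<zeta> * (r_crit p w / (r_crit p w - 1))" using S0 by (rule mult_left_mono)
  then have exps': "?S * \<zeta> \<le> 1 / q" using exps by linarith
  have "\<exists>c. 0 < c \<and> (\<forall>k. int_le M (B k) w (\<lambda>x. (cmod (b i x - wmean p w (B k) (b i)) / c) powr rs i) (W k))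
    \<and> (\<forall>j k. cmod (wmean p w (B j) (b i) - wmean p w (B k) (b i)) \<le> c * real p powr (real CARD('n) * \<zeta> * \<bar>k - j\<bar>))"
    if i: "i \<in> {1..m}" for i
    using CMO_normalised[of "b i" "rs i"] b_CMO rs_ge i by metis
  then obtain c where c: "\<And>i. i \<in> {1..m} \<Longrightarrow> 0 < c i" 
    "\<And>i k. i \<in> {1..m} \<Longrightarrow> int_le M (B k) w (\<lambda>x. (cmod (b i x - wmean p w (B k) (b i)) / c i) powr rs i) (W k)"
    "\<And>i j k. i \<in> {1..m} \<Longrightarrow> cmod (wmean p w (B j) (b i) - wmean p w (B k) (b i)) \<le> c i * real p powr (real CARD('n) * \<zeta> * \<bar>k - j\<bar>)"
    by metis
  interpret commutator p \<zeta> w m q \<delta> rs qs lam \<Omega> \<Phi> b c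
  proof unfold_locales
    show "b i \<in> borel_measurable (haar p)" if "i \<in> {1..m}" for i using b_CMO that by (simp add: CMO_space_def)
    show "1 \<le> rs i" "1 \<le> qs i" "- 1 / qs i < lam i \<and> lam i < 0" if "i \<in> {1..m}" for i
      using rs_ge qs_ge lam that by auto
    show "0 \<le> \<Phi> t" for t using Phi_nonneg by blast
    show "int_le (haar p) (Bg p k) w (\<lambda>x. (cmod (b i x - wmean p w (Bg p k) (b i)) / c i) powr rs i) (wmeas p w (Bg p k))"
      if "i \<in> {1..m}" for i k using c(2)[OF that, of k] by (simp only: W_def)
  qed fact+
  \<comment> \<open>In both ranges the assumed denominator splits into \<open>p^\<gamma>\<close> and
    the reciprocal of \<open>E\<close>, which identifies the general term with
    \<open>G\<close>.\<close>
  have "G summable_on {0..}"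
  proof (rule summable_on_cong[THEN iffD1, OF _ C7_pos])
    fix \<gamma> :: int assume "\<gamma> \<in> {0..}"
    then show "\<Phi> (ppow \<gamma>) / real p powr (real_of_int \<gamma> * (1 + real CARD('n) * \<zeta> * (\<Sum>i\<in>{1..m}. lam i)))
                 * (2 + real p powr (real_of_int \<gamma> * \<zeta> * real CARD('n))) ^ m = G \<gamma>"
      by (simp add: G_def E_def lamS_def distrib_left powr_add powr_minus_divide mult_ac)
  qed
  moreover have "G summable_on {..<0}"
  proof (rule summable_on_cong[THEN iffD1, OF _ C7_neg])
    fix \<gamma> :: int assume "\<gamma> \<in> {..<0}"
    then show "\<Phi> (ppow \<gamma>) / real p powr (real_of_int \<gamma> * (1 + real CARD('n) * (\<Sum>i\<in>{1..m}. lam i) * (\<delta> - 1) / \<delta>))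
                 * (2 + real p powr (- real_of_int \<gamma> * \<zeta> * real CARD('n))) ^ m = G \<gamma>"
      by (simp add: G_def E_def lamS_def d_def distrib_left powr_add powr_minus_divide mult_ac)
  qed
  ultimately have "G summable_on ({0..} \<union> {..<0})" by (intro summable_on_Un_disjoint) auto
  moreover have "{0..} \<union> {..<0} = (UNIV :: int set)" by auto
  ultimately show ?thesis using Hcomm_bounded by (simp add: lamS_def)
qed

end
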